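(* Let $\{X_n\}_{n\ge0}$ be a stationary Markov chain with state space $I\subset\mathbb R$, whose transition kernel has a density $p(x,y)$, i.e. $\mathbb P(X_{n+1}\in A\mid X_n=x)=\int_Ap(x,y)\,dy$, and suppose that $p$ is bounded above and bounded away from $0$ on $I\times I$. Let $\{Y_n\}_{n\ge0}$ be an independent copy of $\{X_n\}_{n\ge0}$, let $\mathbb P_2$ be the law of the pair chain $(X_n,Y_n)_{n\ge0}$, and for $\delta>0$ let $\Delta_\delta=\{(x,y)\in I\times I:|x-y|\le\delta\}$. Then, for every $t>0$, the number of visits $$\mathfrak W=\sum_{i=0}^{N}\mathbf 1_{\Delta_\delta}(X_i,Y_i),\qquad N=\left\lfloor \frac{t}{\mathbb P_2((X_0,Y_0)\in\Delta_\delta)}\right\rfloor,$$ converges in distribution, as $\delta\to0$, to a Poisson random variable with parameter $t$. *)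

theory Defs
  imports "HOL-Probability.Probability"
begin

text \<open>Real-valued processes are random elements of the path space
  \<^term>\<open>PiM UNIV (\<lambda>_. borel)\<close>.\<close>

abbreviation path_space :: "(nat \<Rightarrow> real) measure" where
  "path_space \<equiv> PiM UNIV (\<lambda>_. borel)"

definition trajectory :: "(nat \<Rightarrow> 'a \<Rightarrow> 'b) \<Rightarrow> 'a \<Rightarrow> nat \<Rightarrow> 'b" where
  "trajectory X \<omega> = (\<lambda>n. X n \<omega>)"

definition natural_filtration :: "'a measure \<Rightarrow> (nat \<Rightarrow> 'a \<Rightarrow> real) \<Rightarrow> nat \<Rightarrow> 'a measure" where
  "natural_filtration M X n =
     sigma (space M) (\<Union>i\<in>{..n}. {X i -` A \<inter> space M | A. A \<in> sets borel})"

text \<open>A jointly measurable density, with respect to Lebesgue measure on \<open>I\<close>, of a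
  probability kernel on \<open>I\<close>. Values of \<open>p\<close> outside \<open>I \<times> I\<close> are irrelevant.\<close>

definition transition_density :: "real set \<Rightarrow> (real \<Rightarrow> real \<Rightarrow> real) \<Rightarrow> bool" where
  "transition_density I p \<longleftrightarrow>
     case_prod p \<in> borel_measurable (restrict_space borel I \<Otimes>\<^sub>M restrict_space borel I) \<and>
     (\<forall>x\<in>I. \<forall>y\<in>I. 0 \<le> p x y) \<and>
     (\<forall>x\<in>I. (LINT y:I|lborel. p x y) = 1)"

text \<open>The last condition combines the Markov property with the one-step transition law:
  almost surely, the conditional probability of \<open>X (Suc n) \<in> A\<close> given \<open>X 0, \<dots>, X n\<close> is
  the integral of \<open>p (X n) y\<close> over \<open>y \<in> A\<close>.\<close>

definition markov_chain ::
  "'a measure \<Rightarrow> real set \<Rightarrow> (real \<Rightarrow> real \<Rightarrow> real) \<Rightarrow> (nat \<Rightarrow> 'a \<Rightarrow> real) \<Rightarrow> bool" where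
  "markov_chain M I p X \<longleftrightarrow>
     transition_density I p \<and>
     (\<forall>n. X n \<in> borel_measurable M) \<and>
     (\<forall>n. \<forall>\<omega>\<in>space M. X n \<omega> \<in> I) \<and>
     (\<forall>n. \<forall>A\<in>sets borel. A \<subseteq> I \<longrightarrow>
        (AE \<omega> in M.
           real_cond_exp M (natural_filtration M X n) (indicator (X (Suc n) -` A \<inter> space M)) \<omega>
             = (LINT y:A|lborel. p (X n \<omega>) y)))"

definition stationary :: "'a measure \<Rightarrow> (nat \<Rightarrow> 'a \<Rightarrow> real) \<Rightarrow> bool" where
  "stationary M X \<longleftrightarrow>
     distr M path_space (trajectory (\<lambda>n. X (Suc n))) = distr M path_space (trajectory X)"

definition independent_copy ::
  "'a measure \<Rightarrow> (nat \<Rightarrow> 'a \<Rightarrow> real) \<Rightarrow> (nat \<Rightarrow> 'a \<Rightarrow> real) \<Rightarrow> bool" where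
  "independent_copy M X Y \<longleftrightarrow>
     prob_space.indep_var M path_space (trajectory X) path_space (trajectory Y) \<and>
     distr M path_space (trajectory Y) = distr M path_space (trajectory X)"

definition pair_law ::
  "'a measure \<Rightarrow> (nat \<Rightarrow> 'a \<Rightarrow> real) \<Rightarrow> (nat \<Rightarrow> 'a \<Rightarrow> real) \<Rightarrow> (nat \<Rightarrow> real \<times> real) measure" where
  "pair_law M X Y =
     distr M (PiM UNIV (\<lambda>_. borel \<Otimes>\<^sub>M borel)) (trajectory (\<lambda>n \<omega>. (X n \<omega>, Y n \<omega>)))"

definition near_diagonal :: "real set \<Rightarrow> real \<Rightarrow> (real \<times> real) set" where
  "near_diagonal I \<delta> = {(x, y). x \<in> I \<and> y \<in> I \<and> \<bar>x - y\<bar> \<le> \<delta>}"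

definition num_steps :: "(nat \<Rightarrow> real \<times> real) measure \<Rightarrow> real set \<Rightarrow> real \<Rightarrow> real \<Rightarrow> nat" where
  "num_steps P2 I t \<delta> =
     nat \<lfloor>t / measure P2 {z \<in> space P2. z 0 \<in> near_diagonal I \<delta>}\<rfloor>"

definition visits ::
  "(nat \<Rightarrow> real \<times> real) measure \<Rightarrow> real set \<Rightarrow> real \<Rightarrow> real \<Rightarrow> (nat \<Rightarrow> real \<times> real) \<Rightarrow> real" where
  "visits P2 I t \<delta> z = (\<Sum>i=0..num_steps P2 I t \<delta>. indicator (near_diagonal I \<delta>) (z i))"

end

(* The characteristic function of the number of visits is E (prod_{i<=N} phi(Z_i)) with
   phi = 1 + (s - 1) 1_D, |s| = 1, and is evaluated with the transition operator P of the pair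
   chain: with g_0 = 1, g_{n+1} = P (phi g_n) it equals the stationary mean a_{N+1} of g_{N+1}.
   The density lies between positive constants, so P contracts oscillations (Doeblin), and every
   one-step hitting probability of D is at most a constant times e = mu(D). Hence, for each m,
   g_n is within O(m e + r^m) of its mean a_n with some r < 1, which turns the identity
   a_{n+1} = mu(phi g_n) into a_{n+1} = (1 + (s - 1) e) a_n + e O(m e + r^m). So a_{N+1} is close
   to (1 + (s - 1) e)^(N+1), which tends to exp (t (s - 1)); conclude by Levy's theorem. *)

theory Submission
  imports Defs
begin

section \<open>Kernels with a density bounded above and below\<close>

text \<open>About t / e steps are taken, so an error of order e in each would not vanish in the
  limit: the recursion for the means has to be accurate to o(e). The factor e arises because a_{n+1}
  - (1 + (s - 1) e) a_n is (s - 1) times the integral of g_n - a_n over D alone, and closeness of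
  g_n to its mean supplies the rest. Mixing holds for powers of P, not for the perturbed operator
  sending h to P (phi h); the two are compared over a window of m steps, each costing O(e) because a
  step from any point, also from D, enters D with probability O(e). The window stays fixed while e
  tends to 0 and grows only afterwards. The condition |s| = 1 keeps |g_n| and |1 + (s - 1) e| at
  most 1, so errors add up instead of being amplified. One-step probabilities, controlled by
  Lebesgue measure, become comparable with e by integrating the kernel bounds against mu.\<close>

lemma norm_integral_le_integral:
  fixes f :: "'a \<Rightarrow> 'b::{banach, second_countable_topology}"
  assumes "integrable M f" "integrable M g" "\<And>x. x \<in> space M \<Longrightarrow> norm (f x) \<le> g x"
  shows "norm (\<integral>x. f x \<partial>M) \<le> (\<integral>x. g x \<partial>M)"
  using assms by (intro order_trans[OF integral_norm_bound integral_mono]) auto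

text \<open>Separates the analysis from the process: \<open>\<nu>\<close> stands for Lebesgue
  measure on the state space of the pair, \<open>\<mu>\<close> for its stationary law. Invariance is
  stated for bounded complex functions because it is applied to \<open>gen\<close>.\<close>

locale doeblin_kernel = prob_space \<mu>
  for \<nu> \<mu> :: "'b measure" and q :: "'b \<Rightarrow> 'b \<Rightarrow> real" and c C :: real +
  assumes finite_ref: "finite_measure \<nu>"
    and sets_inv [measurable_cong]: "sets \<mu> = sets \<nu>"
    and q_measurable [measurable]: "case_prod q \<in> borel_measurable (\<nu> \<Otimes>\<^sub>M \<nu>)"
    and c_pos: "0 < c"
    and q_lower: "\<And>z w. z \<in> space \<nu> \<Longrightarrow> w \<in> space \<nu> \<Longrightarrow> c \<le> q z w"
    and q_upper: "\<And>z w. z \<in> space \<nu> \<Longrightarrow> w \<in> space \<nu> \<Longrightarrow> q z w \<le> C"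
    and q_total: "\<And>z. z \<in> space \<nu> \<Longrightarrow> (\<integral>w. q z w \<partial>\<nu>) = 1"
    and q_invariant: "\<And>h :: 'b \<Rightarrow> complex. \<And>B. h \<in> borel_measurable \<nu> \<Longrightarrow>
      (\<And>z. z \<in> space \<nu> \<Longrightarrow> norm (h z) \<le> B) \<Longrightarrow>
      (\<integral>z. (\<integral>w. q z w *\<^sub>R h w \<partial>\<nu>) \<partial>\<mu>) = (\<integral>z. h z \<partial>\<mu>)"
begin

sublocale ref: finite_measure \<nu>
  by (rule finite_ref)

definition trans_op :: "('b \<Rightarrow> complex) \<Rightarrow> 'b \<Rightarrow> complex" where
  "trans_op h z = (\<integral>w. q z w *\<^sub>R h w \<partial>\<nu>)"

lemma space_inv: "space \<mu> = space \<nu>"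
  using sets_inv by (rule sets_eq_imp_space_eq)

lemma q_nonneg: "z \<in> space \<nu> \<Longrightarrow> w \<in> space \<nu> \<Longrightarrow> 0 \<le> q z w"
  using q_lower[of z w] c_pos by linarith

lemma integrable_bounded:
  fixes h :: "'b \<Rightarrow> complex"
  assumes "h \<in> borel_measurable \<nu>" "\<And>z. z \<in> space \<nu> \<Longrightarrow> norm (h z) \<le> B"
  shows "integrable \<nu> h" "integrable \<mu> h"
  using assms
  by (auto intro!: ref.integrable_const_bound[where B=B] integrable_const_bound[where B=B] AE_I2
      simp: space_inv measurable_cong_sets[OF sets_inv refl])

lemma q_section_measurable [measurable]:
  "z \<in> space \<nu> \<Longrightarrow> q z \<in> borel_measurable \<nu>"
  by measurable

lemma q_integrable: "z \<in> space \<nu> \<Longrightarrow> integrable \<nu> (q z)"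
  by (rule ref.integrable_const_bound[where B=C]) (auto intro!: AE_I2 simp: q_nonneg q_upper)

lemma trans_op_integrable:
  fixes h :: "'b \<Rightarrow> complex"
  assumes [measurable]: "h \<in> borel_measurable \<nu>" and "\<And>z. z \<in> space \<nu> \<Longrightarrow> norm (h z) \<le> B"
    and z: "z \<in> space \<nu>"
  shows "integrable \<nu> (\<lambda>w. q z w *\<^sub>R h w)"
  using assms
  by (intro ref.integrable_const_bound[where B="C * B"] AE_I2)
     (auto intro!: mult_mono q_upper simp: q_nonneg abs_of_nonneg order_trans[OF q_nonneg q_upper])

lemma trans_op_measurable [measurable]:
  assumes [measurable]: "h \<in> borel_measurable \<nu>"
  shows "trans_op h \<in> borel_measurable \<nu>"
  unfolding trans_op_def
  by (rule ref.borel_measurable_lebesgue_integral) measurable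

text \<open>The majorant \<open>f\<close> may vary with the point: later it is 2 on \<open>D\<close>
  and 0 elsewhere, so that its integral against \<open>q z\<close> is small although its supremum is
  not.\<close>

lemma norm_trans_op_le:
  assumes [measurable]: "h \<in> borel_measurable \<nu>" "f \<in> borel_measurable \<nu>"
    and "\<And>w. w \<in> space \<nu> \<Longrightarrow> norm (h w) \<le> f w" "\<And>w. w \<in> space \<nu> \<Longrightarrow> f w \<le> B"
    and z: "z \<in> space \<nu>"
  shows "norm (trans_op h z) \<le> (\<integral>w. q z w * f w \<partial>\<nu>)"
proof -
  have f0: "0 \<le> f w" if "w \<in> space \<nu>" for w
    using assms(3)[OF that] norm_ge_zero order_trans by blast
  have *: "norm (q z w *\<^sub>R h w) \<le> q z w * f w" if "w \<in> space \<nu>" for w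
    using assms(3)[OF that] q_nonneg[OF z that] by (auto intro!: mult_left_mono)
  have "integrable \<nu> (\<lambda>w. q z w * f w)"
    using z by (intro ref.integrable_const_bound[where B="C * B"] AE_I2)
     (auto intro!: mult_mono q_upper assms simp: f0 q_nonneg abs_mult abs_of_nonneg
       order_trans[OF q_nonneg q_upper])
  moreover have "integrable \<nu> (\<lambda>w. q z w *\<^sub>R h w)"
    by (rule trans_op_integrable[where B=B]) (use assms order_trans in blast)+
  ultimately show ?thesis
    unfolding trans_op_def using * by (intro norm_integral_le_integral)
qed

lemma trans_op_bounded:
  assumes "h \<in> borel_measurable \<nu>" "\<And>w. w \<in> space \<nu> \<Longrightarrow> norm (h w) \<le> B"
    and "z \<in> space \<nu>"
  shows "norm (trans_op h z) \<le> B"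
  using norm_trans_op_le[of h "\<lambda>_. B" B z] assms by (simp add: q_total)

lemma trans_op_diff:
  assumes "h \<in> borel_measurable \<nu>" "\<And>w. w \<in> space \<nu> \<Longrightarrow> norm (h w) \<le> B"
    and "h' \<in> borel_measurable \<nu>" "\<And>w. w \<in> space \<nu> \<Longrightarrow> norm (h' w) \<le> B'"
    and "z \<in> space \<nu>"
  shows "trans_op (\<lambda>w. h w - h' w) z = trans_op h z - trans_op h' z"
  unfolding trans_op_def scaleR_diff_right
  by (rule Bochner_Integration.integral_diff) (rule trans_op_integrable; use assms in blast)+

lemma trans_op_const: "z \<in> space \<nu> \<Longrightarrow> trans_op (\<lambda>_. k) z = k"
  unfolding trans_op_def using q_integrable[of z] q_total[of z] by simp

section \<open>Doeblin contraction and mixing\<close>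

definition defect :: real where
  "defect = 1 - c * measure \<nu> (space \<nu>)"

lemma defect_bounds: "0 \<le> defect" "defect < 1"
proof -
  obtain z where z: "z \<in> space \<nu>" using not_empty space_inv by auto
  \<comment> \<open>The constant c is a minorant of a density of total mass 1.\<close>
  have "c * measure \<nu> (space \<nu>) = (\<integral>w. c \<partial>\<nu>)" by simp
  also have "\<dots> \<le> (\<integral>w. q z w \<partial>\<nu>)"
    by (rule integral_mono) (auto simp: q_integrable z q_lower)
  finally show "0 \<le> defect" using q_total[OF z] unfolding defect_def by simp
  \<comment> \<open>If \<open>\<nu>\<close> were null, every integral would vanish and
    \<open>q z\<close> could not have total mass 1.\<close>
  have "measure \<nu> (space \<nu>) \<noteq> 0"
  proof
    assume "measure \<nu> (space \<nu>) = 0"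
    then have "emeasure \<nu> (space \<nu>) = 0" by (simp add: ref.emeasure_eq_measure)
    then have "AE w in \<nu>. False" by (auto intro!: AE_I[where N="space \<nu>"])
    then have "(\<integral>w. q z w \<partial>\<nu>) = 0" by (intro integral_eq_zero_AE) auto
    with q_total[OF z] show False by simp
  qed
  then have "0 < measure \<nu> (space \<nu>)" by (simp add: zero_less_measure_iff)
  with c_pos show "defect < 1" unfolding defect_def by simp
qed

text \<open>Subtracting the part \<open>c\<close> of the density common to all starting points leaves a
  kernel of total mass \<open>defect\<close>, and changes \<open>trans_op h\<close> only by a constant.\<close>

lemma trans_op_near_const:
  assumes [measurable]: "h \<in> borel_measurable \<nu>"
    and bd: "\<And>w. w \<in> space \<nu> \<Longrightarrow> norm (h w - k) \<le> B"
  shows "\<exists>k'. \<forall>z\<in>space \<nu>. norm (trans_op h z - k') \<le> defect * B"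
proof (intro exI ballI)
  let ?h = "\<lambda>w. h w - k"
  fix z assume z: "z \<in> space \<nu>"
  have hb: "norm (h w) \<le> B + norm k" if "w \<in> space \<nu>" for w
    using bd[OF that] norm_triangle_sub[of "h w" k] by simp
  have i1: "integrable \<nu> (\<lambda>w. q z w *\<^sub>R ?h w)"
    by (rule trans_op_integrable[OF _ bd z]) measurable
  have i2: "integrable \<nu> (\<lambda>w. c *\<^sub>R ?h w)"
    by (rule integrable_scaleR_right, rule integrable_bounded(1)[OF _ bd]) measurable
  have "trans_op h z - (k + (\<integral>w. c *\<^sub>R ?h w \<partial>\<nu>)) = trans_op ?h z - (\<integral>w. c *\<^sub>R ?h w \<partial>\<nu>)"
    using trans_op_diff[of h "B + norm k" "\<lambda>_. k" "norm k" z] hb z by (simp add: trans_op_const)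
  also have "\<dots> = (\<integral>w. (q z w - c) *\<^sub>R ?h w \<partial>\<nu>)"
    unfolding trans_op_def by (subst Bochner_Integration.integral_diff[OF i1 i2, symmetric])
      (simp add: scaleR_diff_left)
  finally have eq: "trans_op h z - (k + (\<integral>w. c *\<^sub>R ?h w \<partial>\<nu>)) = (\<integral>w. (q z w - c) *\<^sub>R ?h w \<partial>\<nu>)" .
  have "norm (\<integral>w. (q z w - c) *\<^sub>R ?h w \<partial>\<nu>) \<le> (\<integral>w. (q z w - c) * B \<partial>\<nu>)"
  proof (rule norm_integral_le_integral)
    show "integrable \<nu> (\<lambda>w. (q z w - c) *\<^sub>R ?h w)"
      unfolding scaleR_diff_left by (rule Bochner_Integration.integrable_diff[OF i1 i2])
    show "integrable \<nu> (\<lambda>w. (q z w - c) * B)" using q_integrable[OF z] by simp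
    show "norm ((q z w - c) *\<^sub>R ?h w) \<le> (q z w - c) * B" if "w \<in> space \<nu>" for w
      using bd[OF that] q_lower[OF z that] by (auto intro!: mult_left_mono)
  qed
  also have "\<dots> = defect * B"
    using q_integrable[OF z] q_total[OF z] by (simp add: defect_def mult.commute)
  finally show "norm (trans_op h z - (k + (\<integral>w. c *\<^sub>R ?h w \<partial>\<nu>))) \<le> defect * B"
    using eq by simp
qed

lemma trans_op_iter_measurable [measurable]:
  "h \<in> borel_measurable \<nu> \<Longrightarrow> (trans_op ^^ m) h \<in> borel_measurable \<nu>"
  by (induction m) auto

lemma trans_op_iter_bounded:
  assumes "h \<in> borel_measurable \<nu>" "\<And>w. w \<in> space \<nu> \<Longrightarrow> norm (h w) \<le> B"
    and "z \<in> space \<nu>"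
  shows "norm ((trans_op ^^ m) h z) \<le> B"
  using assms by (induction m arbitrary: z) (auto intro!: trans_op_bounded)

lemma trans_op_iter_invariant:
  assumes "h \<in> borel_measurable \<nu>" "\<And>w. w \<in> space \<nu> \<Longrightarrow> norm (h w) \<le> B"
  shows "(\<integral>z. (trans_op ^^ m) h z \<partial>\<mu>) = (\<integral>z. h z \<partial>\<mu>)"
proof (induction m)
  case (Suc m)
  have "(\<integral>z. trans_op ((trans_op ^^ m) h) z \<partial>\<mu>) = (\<integral>z. (trans_op ^^ m) h z \<partial>\<mu>)"
    unfolding trans_op_def[of "(trans_op ^^ m) h"]
    by (rule q_invariant[where B=B]) (use assms trans_op_iter_bounded in auto)
  with Suc show ?case by simp
qed simp

lemma norm_integral_diff_le:
  fixes h :: "'b \<Rightarrow> complex"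
  assumes "h \<in> borel_measurable \<nu>" "\<And>z. z \<in> space \<nu> \<Longrightarrow> norm (h z) \<le> A"
    and "\<And>z. z \<in> space \<nu> \<Longrightarrow> norm (h z - k) \<le> B"
  shows "norm ((\<integral>z. h z \<partial>\<mu>) - k) \<le> B"
proof -
  have i: "integrable \<mu> h" by (rule integrable_bounded(2)[OF assms(1,2)])
  then have "(\<integral>z. h z \<partial>\<mu>) - k = (\<integral>z. h z - k \<partial>\<mu>)" by (simp add: prob_space)
  also have "norm \<dots> \<le> (\<integral>z. B \<partial>\<mu>)"
    by (rule norm_integral_le_integral) (use i assms(3) in \<open>auto simp: space_inv\<close>)
  finally show ?thesis by (simp add: prob_space)
qed

text \<open>Iterating the contraction brings the m-th iterate within \<open>defect ^ m * B\<close>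
  of some constant. Invariance preserves the mean, which is therefore equally close to that
  constant; hence the factor 2.\<close>

lemma trans_op_mixing:
  assumes meas: "h \<in> borel_measurable \<nu>" and bd: "\<And>w. w \<in> space \<nu> \<Longrightarrow> norm (h w) \<le> B"
    and z: "z \<in> space \<nu>"
  shows "norm ((trans_op ^^ m) h z - (\<integral>z. h z \<partial>\<mu>)) \<le> 2 * defect ^ m * B"
proof -
  have "\<exists>k. \<forall>z\<in>space \<nu>. norm ((trans_op ^^ m) h z - k) \<le> defect ^ m * B"
  proof (induction m)
    case 0
    show ?case using bd by (intro exI[of _ 0]) simp
  next
    case (Suc m)
    then obtain k where "\<forall>z\<in>space \<nu>. norm ((trans_op ^^ m) h z - k) \<le> defect ^ m * B" by blast
    then show ?case
      using trans_op_near_const[of "(trans_op ^^ m) h" k "defect ^ m * B"] meas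
      by (auto simp: mult_ac)
  qed
  then obtain k where k: "\<And>z. z \<in> space \<nu> \<Longrightarrow> norm ((trans_op ^^ m) h z - k) \<le> defect ^ m * B"
    by blast
  have "norm ((\<integral>z. (trans_op ^^ m) h z \<partial>\<mu>) - k) \<le> defect ^ m * B"
    using norm_integral_diff_le[of "(trans_op ^^ m) h" B k] meas bd trans_op_iter_bounded k by auto
  then have "norm ((\<integral>z. h z \<partial>\<mu>) - k) \<le> defect ^ m * B"
    using trans_op_iter_invariant[OF meas bd] by simp
  with k[OF z] show ?thesis
    using norm_triangle_ineq4[of "(trans_op ^^ m) h z - k" "(\<integral>z. h z \<partial>\<mu>) - k"] by simp
qed

section \<open>One-step probabilities against the stationary measure\<close>

lemma const_ge_one: "1 \<le> C / c"
proof -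
  obtain z where z: "z \<in> space \<nu>" using not_empty space_inv by auto
  show ?thesis using q_lower[OF z z] q_upper[OF z z] c_pos by simp
qed

lemma C_nonneg: "0 \<le> C"
  using const_ge_one c_pos by (simp add: le_divide_eq)

lemma transition_prob_bounds:
  assumes D [measurable]: "D \<in> sets \<nu>" and z: "z \<in> space \<nu>"
  shows "c * measure \<nu> D \<le> (\<integral>w. q z w * indicator D w \<partial>\<nu>)"
    and "(\<integral>w. q z w * indicator D w \<partial>\<nu>) \<le> C * measure \<nu> D"
proof -
  have i: "integrable \<nu> (\<lambda>w. q z w * indicator D w)"
    using integrable_mult_indicator[OF D q_integrable[OF z]] by (simp add: mult.commute)
  have "(\<integral>w. c * indicator D w \<partial>\<nu>) \<le> (\<integral>w. q z w * indicator D w \<partial>\<nu>)"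
    by (rule integral_mono[OF _ i])
       (use z q_lower in \<open>auto simp: ref.emeasure_eq_measure split: split_indicator\<close>)
  then show "c * measure \<nu> D \<le> (\<integral>w. q z w * indicator D w \<partial>\<nu>)" by simp
  have "(\<integral>w. q z w * indicator D w \<partial>\<nu>) \<le> (\<integral>w. C * indicator D w \<partial>\<nu>)"
    by (rule integral_mono[OF i])
       (use z in \<open>auto simp: q_upper ref.emeasure_eq_measure split: split_indicator\<close>)
  then show "(\<integral>w. q z w * indicator D w \<partial>\<nu>) \<le> C * measure \<nu> D" by simp
qed

text \<open>Invariance writes \<open>measure \<mu> D\<close> as the \<open>\<mu>\<close>-average of
  the one-step probabilities of \<open>D\<close>, and uniform bounds survive averaging.\<close>

lemma measure_inv_bounds:
  assumes D [measurable]: "D \<in> sets \<nu>"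
  shows "c * measure \<nu> D \<le> measure \<mu> D" and "measure \<mu> D \<le> C * measure \<nu> D"
proof -
  let ?f = "\<lambda>z. \<integral>w. q z w * indicator D w \<partial>\<nu>"
  \<comment> \<open>The detour through complex values is due to \<open>q_invariant\<close>, which
    speaks of complex functions.\<close>
  have qi: "complex_of_real (?f z) = trans_op (\<lambda>w. of_real (indicator D w)) z"
    if "z \<in> space \<nu>" for z
    using that unfolding trans_op_def by (subst integral_complex_of_real[symmetric])
      (simp add: scaleR_conv_of_real)
  have [measurable]: "?f \<in> borel_measurable \<nu>"
    by (rule ref.borel_measurable_lebesgue_integral) measurable
  have f_nonneg: "0 \<le> ?f z" if "z \<in> space \<nu>" for z
    by (rule order_trans[OF _ transition_prob_bounds(1)[OF D that]])
       (simp add: less_imp_le[OF c_pos])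
  have int: "integrable \<mu> ?f"
    by (rule integrable_const_bound[where B="C * measure \<nu> D"])
       (auto simp: space_inv measurable_cong_sets[OF sets_inv refl] f_nonneg
         intro!: AE_I2 transition_prob_bounds)
  have "complex_of_real (\<integral>z. ?f z \<partial>\<mu>) = (\<integral>z. trans_op (\<lambda>w. of_real (indicator D w)) z \<partial>\<mu>)"
    by (rule trans[OF integral_complex_of_real[symmetric]],
        rule Bochner_Integration.integral_cong[OF refl], rule qi) (simp add: space_inv)
  also have "\<dots> = (\<integral>z. of_real (indicator D z) \<partial>\<mu>)"
    unfolding trans_op_def by (rule q_invariant[where B=1]) (auto split: split_indicator)
  also have "\<dots> = complex_of_real (measure \<mu> D)"
    using D by (simp add: sets_inv)
  finally have eq: "measure \<mu> D = (\<integral>z. ?f z \<partial>\<mu>)"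
    using of_real_eq_iff by metis
  have "(\<integral>z. c * measure \<nu> D \<partial>\<mu>) \<le> (\<integral>z. ?f z \<partial>\<mu>)"
    by (rule integral_mono[OF _ int]) (auto simp: space_inv intro!: transition_prob_bounds)
  then show "c * measure \<nu> D \<le> measure \<mu> D" by (simp add: eq prob_space)
  have "(\<integral>z. ?f z \<partial>\<mu>) \<le> (\<integral>z. C * measure \<nu> D \<partial>\<mu>)"
    by (rule integral_mono[OF int]) (auto simp: space_inv intro!: transition_prob_bounds)
  then show "measure \<mu> D \<le> C * measure \<nu> D" by (simp add: eq prob_space)
qed

text \<open>Restates the upper bound in terms of the stationary mass of \<open>D\<close>, the scale
  in which time is measured. Its uniformity in \<open>z\<close>, also for \<open>z\<close> in
  \<open>D\<close>, is what excludes clusters of visits.\<close>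

lemma transition_prob_le:
  assumes D: "D \<in> sets \<nu>" and z: "z \<in> space \<nu>"
  shows "(\<integral>w. q z w * indicator D w \<partial>\<nu>) \<le> C / c * measure \<mu> D"
  using transition_prob_bounds(2)[OF D z] mult_left_mono[OF measure_inv_bounds(1)[OF D], of "C / c"]
    c_pos C_nonneg by simp

lemma add_of_nat_mult: "(x::real) + real m * x = real (Suc m) * x"
  by (simp add: algebra_simps)

section \<open>The perturbed operator and its means\<close>

context
  fixes D :: "'b set" and s :: complex
  assumes D [measurable]: "D \<in> sets \<nu>" and s: "norm s = 1"
begin

text \<open>This is s to the power \<open>indicator D w\<close>, so a product of weights along a
  path is s to the number of visits. The form affine in the indicator is what later splits off the
  mass of \<open>D\<close>.\<close>

definition weight :: "'b \<Rightarrow> complex" where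
  "weight w = 1 + (s - 1) * of_real (indicator D w)"

text \<open>\<open>gen n z\<close> is the expectation of the product of the weights at times 1 to n
  for the chain started at \<open>z\<close>: each weight sits on the point of arrival, so time 0 is
  not counted.\<close>

primrec gen :: "nat \<Rightarrow> 'b \<Rightarrow> complex" where
  "gen 0 = (\<lambda>_. 1)"
| "gen (Suc n) = trans_op (\<lambda>w. weight w * gen n w)"

definition gen_mean :: "nat \<Rightarrow> complex" where
  "gen_mean n = (\<integral>z. gen n z \<partial>\<mu>)"

abbreviation (input) "\<epsilon> \<equiv> measure \<mu> D"

lemma weight_measurable [measurable]: "weight \<in> borel_measurable \<nu>"
  unfolding weight_def[abs_def] by measurable

lemma norm_weight: "norm (weight w) = 1"
  using s by (auto simp: weight_def split: split_indicator)

lemma norm_s_diff: "norm (s - 1) \<le> 2"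
  using norm_triangle_ineq4[of s 1] s by simp

lemma gen_measurable [measurable]: "gen n \<in> borel_measurable \<nu>"
  by (induction n) auto

lemma norm_gen_le: "z \<in> space \<nu> \<Longrightarrow> norm (gen n z) \<le> 1"
  by (induction n arbitrary: z) (auto intro!: trans_op_bounded simp: norm_mult norm_weight)

text \<open>Omitting the weight in one step costs at most |s - 1| times the probability of landing
  in \<open>D\<close>. The transition operator does not enlarge earlier errors, so m omissions cost
  m times as much.\<close>

lemma gen_near_iter:
  assumes z: "z \<in> space \<nu>"
  shows "norm (gen (m + k) z - (trans_op ^^ m) (gen k) z) \<le> real m * (2 * (C / c) * \<epsilon>)"
  using z
proof (induction m arbitrary: z)
  case (Suc m)
  let ?K = "2 * (C / c) * \<epsilon>"
  let ?g = "gen (m + k)" and ?h = "(trans_op ^^ m) (gen k)"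
  have hb: "norm (?h w) \<le> 1" if "w \<in> space \<nu>" for w
    by (rule trans_op_iter_bounded) (use that norm_gen_le in auto)
  have "trans_op (\<lambda>w. weight w * ?g w) z - trans_op ?g z = trans_op (\<lambda>w. weight w * ?g w - ?g w) z"
    by (rule trans_op_diff[where B=1 and B'=1, symmetric])
       (auto simp: norm_mult norm_weight norm_gen_le Suc.prems)
  also have "norm \<dots> \<le> (\<integral>w. q z w * (2 * indicator D w) \<partial>\<nu>)"
  proof (rule norm_trans_op_le[where B=2])
    fix w assume w: "w \<in> space \<nu>"
    have "weight w * ?g w - ?g w = (s - 1) * ?g w * of_real (indicator D w)"
      by (simp add: weight_def algebra_simps)
    also have "norm \<dots> \<le> 2 * 1 * indicator D w"
      unfolding norm_mult using norm_s_diff norm_gen_le[OF w]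
      by (intro mult_mono) auto
    finally show "norm (weight w * ?g w - ?g w) \<le> 2 * indicator D w" by simp
  qed (auto simp: Suc.prems split: split_indicator)
  also have "\<dots> = 2 * (\<integral>w. q z w * indicator D w \<partial>\<nu>)"
    by (subst integral_mult_right_zero[symmetric]) (simp add: mult_ac)
  also have "\<dots> \<le> ?K" using transition_prob_le[OF D Suc.prems] by simp
  finally have 1: "norm (trans_op (\<lambda>w. weight w * ?g w) z - trans_op ?g z) \<le> ?K" .
  have "trans_op ?g z - trans_op ?h z = trans_op (\<lambda>w. ?g w - ?h w) z"
    by (rule trans_op_diff[where B=1 and B'=1, symmetric])
       (auto simp: norm_gen_le hb Suc.prems)
  also have "norm \<dots> \<le> real m * ?K"
    by (rule trans_op_bounded) (use Suc in auto)
  finally have 2: "norm (trans_op ?g z - trans_op ?h z) \<le> real m * ?K" .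
  have "norm (gen (Suc m + k) z - (trans_op ^^ Suc m) (gen k) z) \<le> ?K + real m * ?K"
    using norm_triangle_le[OF add_mono[OF 1 2]] by simp
  also have "\<dots> = real (Suc m) * ?K" by (rule add_of_nat_mult)
  finally show ?case .
qed simp

text \<open>The window cost is paid twice, at the point z and again after averaging, which turns the
  2 of \<open>gen_near_iter\<close> into 4; mixing is paid once. The length m is free and is chosen
  only in the limit.\<close>

lemma gen_near_mean:
  assumes z: "z \<in> space \<nu>"
  shows "norm (gen n z - gen_mean n) \<le> 4 * real m * (C / c) * \<epsilon> + 2 * defect ^ m"
proof -
  \<comment> \<open>The window must fit into the n available steps. For n < m it uses all of them;
    then k = 0 and only the constant 1 is propagated, which the kernel fixes.\<close>
  define j where "j = min m n"
  obtain k where k: "n = j + k" unfolding j_def by (metis le_add_diff_inverse min.cobounded2)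
  let ?K = "2 * (C / c) * \<epsilon>"
  let ?h = "(trans_op ^^ j) (gen k)"
  have K0: "0 \<le> ?K"
    by (intro mult_nonneg_nonneg order_trans[OF _ const_ge_one]) auto
  have jm: "real j * ?K \<le> real m * ?K" by (intro mult_right_mono K0) (simp add: j_def)
  have hb: "norm (?h w) \<le> 1" if "w \<in> space \<nu>" for w
    by (rule trans_op_iter_bounded) (use that norm_gen_le in auto)
  have inv: "(\<integral>z. ?h z \<partial>\<mu>) = gen_mean k"
    unfolding gen_mean_def by (rule trans_op_iter_invariant[where B=1]) (auto simp: norm_gen_le)
  have 1: "norm (gen n z - ?h z) \<le> real m * ?K"
    using gen_near_iter[OF z, of j k] jm by (simp add: k)
  have "gen_mean n - gen_mean k = (\<integral>z. gen n z - ?h z \<partial>\<mu>)"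
    unfolding inv[symmetric] unfolding gen_mean_def
    by (rule Bochner_Integration.integral_diff[symmetric]; rule integrable_bounded(2)[of _ 1])
       (auto simp: norm_gen_le hb)
  also have "norm (\<dots> - 0) \<le> real m * ?K"
  proof (rule norm_integral_diff_le)
    fix w assume "w \<in> space \<nu>"
    then show "norm (gen n w - ?h w) \<le> real m * ?K" "norm (gen n w - ?h w - 0) \<le> real m * ?K"
      using gen_near_iter[of w j k] jm by (simp_all add: k)
  qed measurable
  finally have 2: "norm (gen_mean n - gen_mean k) \<le> real m * ?K" unfolding diff_zero .
  have 3: "norm (?h z - gen_mean k) \<le> 2 * defect ^ m"
  proof (cases "m \<le> n")
    case True
    then have "j = m" by (simp add: j_def)
    with trans_op_mixing[of "gen k" 1 z m] z show ?thesis
      by (simp add: norm_gen_le gen_mean_def)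
  next
    case False
    then have "j = n" by (simp add: j_def)
    then have k0: "k = 0" using k by linarith
    have "(trans_op ^^ i) (\<lambda>_. 1) w = 1" if "w \<in> space \<nu>" for i w
      using that
    proof (induction i arbitrary: w)
      case (Suc i)
      have "trans_op ((trans_op ^^ i) (\<lambda>_. 1)) w = trans_op (\<lambda>_. 1) w"
        unfolding trans_op_def[of _ w] by (rule Bochner_Integration.integral_cong) (auto simp: Suc.IH)
      with Suc.prems show ?case by (simp add: trans_op_const)
    qed simp
    then have "?h z = 1" using z k0 by simp
    moreover have "gen_mean k = 1" by (simp add: k0 gen_mean_def prob_space)
    ultimately show ?thesis using defect_bounds by simp
  qed
  have "gen n z - gen_mean n = (gen n z - ?h z) + (?h z - gen_mean k) - (gen_mean n - gen_mean k)"
    by simp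
  also have "norm \<dots> \<le> real m * ?K + 2 * defect ^ m + real m * ?K"
    by (intro order_trans[OF norm_triangle_ineq4] add_mono order_trans[OF norm_triangle_ineq] 1 2 3)
  finally show ?thesis by (simp add: algebra_simps)
qed

text \<open>Invariance removes the outer transition operator and exposes a weight at time 0. Hence
  \<open>gen_mean (Suc n)\<close> accounts for the n + 1 times 0 to n.\<close>

lemma gen_mean_Suc: "gen_mean (Suc n) = (\<integral>z. weight z * gen n z \<partial>\<mu>)"
  unfolding gen_mean_def gen.simps trans_op_def
  by (rule q_invariant[where B=1]) (auto simp: norm_mult norm_weight norm_gen_le)

text \<open>The difference is the integral of (s - 1) times \<open>gen n z - gen_mean n\<close> over
  \<open>D\<close> alone. The domain gives the factor \<open>\<epsilon>\<close> and
  \<open>gen_near_mean\<close> the other one, so the error can be made small relative to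
  \<open>\<epsilon>\<close>.\<close>

lemma gen_mean_step:
  "norm (gen_mean (Suc n) - (1 + (s - 1) * of_real \<epsilon>) * gen_mean n)
    \<le> 2 * \<epsilon> * (4 * real m * (C / c) * \<epsilon> + 2 * defect ^ m)" (is "_ \<le> 2 * \<epsilon> * ?\<eta>")
proof -
  have D': "D \<in> sets \<mu>" by (simp add: sets_inv)
  note gen_mean_Suc[of n]
  moreover have i1: "integrable \<mu> (\<lambda>z. weight z * gen n z)"
    by (rule integrable_bounded(2)[where B=1]) (auto simp: norm_mult norm_weight norm_gen_le)
  moreover have i2: "integrable \<mu> (gen n)"
    by (rule integrable_bounded(2)[where B=1]) (auto simp: norm_gen_le)
  moreover have i3: "integrable \<mu> (\<lambda>z. complex_of_real (indicator D z))"
    by (rule integrable_bounded(2)[where B=1]) (auto split: split_indicator)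
  moreover have "(\<integral>z. complex_of_real (indicator D z) \<partial>\<mu>) = of_real \<epsilon>"
    using D' by simp
  ultimately have "gen_mean (Suc n) - (1 + (s - 1) * of_real \<epsilon>) * gen_mean n =
      (\<integral>z. weight z * gen n z - gen n z - (s - 1) * gen_mean n * of_real (indicator D z) \<partial>\<mu>)"
    by (simp add: gen_mean_def[of n] algebra_simps)
  also have "norm \<dots> \<le> (\<integral>z. 2 * ?\<eta> * indicator D z \<partial>\<mu>)"
  proof (rule norm_integral_le_integral)
    show "integrable \<mu> (\<lambda>z. weight z * gen n z - gen n z - (s - 1) * gen_mean n * of_real (indicator D z))"
      using i1 i2 i3 by auto
    show "integrable \<mu> (\<lambda>z. 2 * ?\<eta> * indicator D z)" using D' by (auto simp: emeasure_eq_measure)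
    fix z assume "z \<in> space \<mu>"
    then have z: "z \<in> space \<nu>" by (simp add: space_inv)
    have "weight z * gen n z - gen n z - (s - 1) * gen_mean n * of_real (indicator D z) =
        (s - 1) * (gen n z - gen_mean n) * of_real (indicator D z)"
      by (simp add: weight_def algebra_simps)
    also have "norm \<dots> \<le> 2 * ?\<eta> * indicator D z"
      unfolding norm_mult by (intro mult_mono norm_s_diff gen_near_mean z)
        (use const_ge_one in \<open>auto simp: defect_bounds less_imp_le[OF c_pos] C_nonneg split: split_indicator\<close>)
    finally show "norm (weight z * gen n z - gen n z - (s - 1) * gen_mean n * of_real (indicator D z))
        \<le> 2 * ?\<eta> * indicator D z" .
  qed
  also have "\<dots> = 2 * \<epsilon> * ?\<eta>" using D' by simp
  finally show ?thesis .
qed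

text \<open>The one-step errors add up without amplification because the multiplier lies in the
  closed unit disc.\<close>

lemma gen_mean_near_power:
  "norm (gen_mean n - (1 + (s - 1) * of_real \<epsilon>) ^ n)
    \<le> real n * (2 * \<epsilon> * (4 * real m * (C / c) * \<epsilon> + 2 * defect ^ m))" (is "_ \<le> real n * ?e")
proof (induction n)
  case 0
  show ?case by (simp add: gen_mean_def prob_space)
next
  case (Suc n)
  let ?r = "1 + (s - 1) * complex_of_real \<epsilon>"
  \<comment> \<open>A convex combination of 1 and s, both of modulus 1.\<close>
  have "?r = of_real (1 - \<epsilon>) + s * of_real \<epsilon>" by (simp add: algebra_simps)
  also have "norm \<dots> \<le> \<bar>1 - \<epsilon>\<bar> + \<epsilon>"
    by (rule order_trans[OF norm_triangle_ineq]) (simp only: norm_mult s norm_of_real; simp)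
  finally have r: "norm ?r \<le> 1" using prob_le_1[of D] by simp
  have "gen_mean (Suc n) - ?r ^ Suc n = (gen_mean (Suc n) - ?r * gen_mean n) + ?r * (gen_mean n - ?r ^ n)"
    by (simp add: algebra_simps)
  also have "norm \<dots> \<le> ?e + real n * ?e"
    by (intro order_trans[OF norm_triangle_ineq] add_mono gen_mean_step)
       (unfold norm_mult, intro order_trans[OF mult_mono[OF r Suc]], auto)
  also have "\<dots> = real (Suc n) * ?e" by (rule add_of_nat_mult)
  finally show ?case .
qed

end

end

section \<open>The Markov property on path space\<close>

text \<open>Encodes the history up to time n as a path frozen at n, so that histories live in
  \<open>path_space\<close> itself and functions of the past are functions of paths.\<close>

definition stopped :: "nat \<Rightarrow> (nat \<Rightarrow> 'b) \<Rightarrow> nat \<Rightarrow> 'b" where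
  "stopped n x = (\<lambda>i. x (min i n))"

lemma stopped_apply: "i \<le> n \<Longrightarrow> stopped n x i = x i"
  by (simp add: stopped_def)

lemma stopped_measurable [measurable]: "stopped n \<in> path_space \<rightarrow>\<^sub>M path_space"
  unfolding stopped_def[abs_def] by (rule measurable_PiM_single') auto

lemma trajectory_measurable [measurable]:
  "(\<And>n. X n \<in> borel_measurable M) \<Longrightarrow> trajectory X \<in> M \<rightarrow>\<^sub>M path_space"
  unfolding trajectory_def[abs_def] by (rule measurable_PiM_single') auto

lemma sets_natural_filtration:
  "sets (natural_filtration M X n) =
     sigma_sets (space M) (\<Union>i\<in>{..n}. {X i -` A \<inter> space M | A. A \<in> sets borel})"
  unfolding natural_filtration_def by (rule sets_measure_of) auto

lemma space_natural_filtration: "space (natural_filtration M X n) = space M"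
  unfolding natural_filtration_def by (rule space_measure_of) auto

lemma subalgebra_natural_filtration:
  assumes "\<And>n. X n \<in> borel_measurable M"
  shows "subalgebra M (natural_filtration M X n)"
  unfolding subalgebra_def sets_natural_filtration space_natural_filtration
  using assms by (auto intro!: sets.sigma_sets_subset)

lemma natural_filtration_measurable:
  "i \<le> n \<Longrightarrow> X i \<in> borel_measurable (natural_filtration M X n)"
  by (rule measurableI) (auto simp: space_natural_filtration sets_natural_filtration)

lemma stopped_trajectory_adapted:
  "(\<lambda>\<omega>. stopped n (trajectory X \<omega>)) \<in> natural_filtration M X n \<rightarrow>\<^sub>M path_space"
  unfolding stopped_def trajectory_def
  by (rule measurable_PiM_single') (auto intro: natural_filtration_measurable)

section \<open>The density extended by zero\<close>

locale bounded_density =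
  fixes I :: "real set" and p :: "real \<Rightarrow> real \<Rightarrow> real" and c C :: real
  assumes I_borel [measurable]: "I \<in> sets borel"
    and density: "transition_density I p"
    and c_pos: "0 < c"
    and p_lower: "\<And>x y. x \<in> I \<Longrightarrow> y \<in> I \<Longrightarrow> c \<le> p x y"
    and p_upper: "\<And>x y. x \<in> I \<Longrightarrow> y \<in> I \<Longrightarrow> p x y \<le> C"
    and I_nonempty: "I \<noteq> {}"
begin

text \<open>\<open>p\<close> is arbitrary off I \<times> I, possibly not measurable. Extension by
  zero yields a Borel function on the plane, so integrals run over all of \<open>lborel\<close>; a
  starting point outside \<open>I\<close> gets mass 0.\<close>

definition ext :: "real \<Rightarrow> real \<Rightarrow> real" where
  "ext x y = (if x \<in> I \<and> y \<in> I then p x y else 0)"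

lemma ext_measurable_pair: "case_prod ext \<in> borel_measurable (borel \<Otimes>\<^sub>M borel)"
proof -
  have "(\<lambda>z. (fst z, snd z)) \<in> restrict_space (borel \<Otimes>\<^sub>M borel) (I \<times> I) \<rightarrow>\<^sub>M
      restrict_space borel I \<Otimes>\<^sub>M restrict_space borel I"
    by (intro measurable_Pair measurable_restrict_space2 measurable_restrict_space1)
       (auto simp: space_restrict_space)
  moreover have "case_prod p \<in> borel_measurable (restrict_space borel I \<Otimes>\<^sub>M restrict_space borel I)"
    using density unfolding transition_density_def by blast
  ultimately have "(\<lambda>z. case_prod p (fst z, snd z)) \<in>
      borel_measurable (restrict_space (borel \<Otimes>\<^sub>M borel) (I \<times> I))"
    by (rule measurable_compose)
  then have "(\<lambda>z. if z \<in> I \<times> I then case_prod p (fst z, snd z) else 0) \<in>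
      borel_measurable (borel \<Otimes>\<^sub>M borel)"
    by (rule measurable_restrict_space_iff[THEN iffD1, rotated 2]) measurable
  also have "(\<lambda>z. if z \<in> I \<times> I then case_prod p (fst z, snd z) else 0) = case_prod ext"
    by (auto simp: ext_def fun_eq_iff)
  finally show ?thesis .
qed

lemma ext_measurable [measurable (raw)]:
  "f \<in> borel_measurable N \<Longrightarrow> g \<in> borel_measurable N \<Longrightarrow> (\<lambda>w. ext (f w) (g w)) \<in> borel_measurable N"
  using measurable_compose[OF measurable_Pair ext_measurable_pair, of f N g] by simp

lemma C_nonneg: "0 \<le> C"
  using I_nonempty p_lower p_upper c_pos by fastforce

lemma ext_nonneg: "0 \<le> ext x y"
  using p_lower[of x y] c_pos by (auto simp: ext_def)

lemma ext_upper: "ext x y \<le> C"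
  using p_upper C_nonneg by (auto simp: ext_def)

lemma ext_total: "x \<in> I \<Longrightarrow> (\<integral>y. ext x y \<partial>lborel) = 1"
proof -
  assume "x \<in> I"
  then have "(\<integral>y. ext x y \<partial>lborel) = (LINT y:I|lborel. p x y)"
    unfolding set_lebesgue_integral_def
    by (intro Bochner_Integration.integral_cong) (auto simp: ext_def)
  with density \<open>x \<in> I\<close> show ?thesis by (simp add: transition_density_def)
qed

lemma ext_integrable: "integrable lborel (ext x)"
proof (cases "x \<in> I")
  case True
  \<comment> \<open>A function that is not integrable would have integral 0 by convention, not
    1.\<close>
  then show ?thesis using ext_total[of x] not_integrable_integral_eq by fastforce
next
  case False
  then have "ext x = (\<lambda>_. 0)" by (auto simp: ext_def)
  then show ?thesis by simp
qed

lemma ext_total_le: "(\<integral>y. ext x y \<partial>lborel) \<le> 1"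
  using ext_total[of x] by (cases "x \<in> I") (auto simp: ext_def)

lemma nn_integral_ext: "(\<integral>\<^sup>+y. ext x y * indicator B y \<partial>lborel) = (\<integral>y. ext x y * indicator B y \<partial>lborel)"
  if [measurable]: "B \<in> sets borel"
  by (rule nn_integral_eq_integral)
     (auto intro!: integrable_real_mult_indicator ext_integrable simp: ext_nonneg)

text \<open>A density of total mass 1 that stays above c on \<open>I\<close> forces the measure of
  \<open>I\<close> to be at most 1 / c.\<close>

lemma emeasure_I_finite: "emeasure lborel I < \<infinity>"
proof -
  obtain x where x: "x \<in> I" using I_nonempty by auto
  have "integrable lborel (\<lambda>y. c * indicator I y)"
    by (rule Bochner_Integration.integrable_bound[OF ext_integrable[of x]])
       (use x p_lower c_pos in \<open>auto simp: ext_def split: split_indicator intro!: AE_I2\<close>,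
        meson less_le_trans order_less_imp_le abs_ge_self order_trans p_lower)
  then have "integrable lborel (\<lambda>y. (1 / c) * (c * indicator I y) :: real)"
    by (rule integrable_mult_right)
  then show ?thesis using c_pos by (simp add: integrable_indicator_iff)
qed

lemma ext_product_integrable:
  fixes h :: "real \<times> real \<Rightarrow> complex"
  assumes h [measurable]: "h \<in> borel_measurable (borel \<Otimes>\<^sub>M borel)" and h_le: "\<And>w. norm (h w) \<le> B"
  shows "integrable (lborel \<Otimes>\<^sub>M lborel) (\<lambda>w. (ext a (fst w) * ext b (snd w)) *\<^sub>R h w)"
proof (rule Bochner_Integration.integrable_bound)
  have B: "0 \<le> B" using h_le[of undefined] norm_ge_zero order_trans by blast
  have "emeasure (lborel \<Otimes>\<^sub>M lborel) (I \<times> I) < \<infinity>"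
    using emeasure_I_finite by (simp add: lborel.emeasure_pair_measure_Times ennreal_mult_less_top)
  then show "integrable (lborel \<Otimes>\<^sub>M lborel) (\<lambda>w. C * C * B * indicator (I \<times> I) w)"
    by simp
  have *: "ext a (fst w) * ext b (snd w) * norm (h w) \<le> C * C * B" for w
    by (intro mult_mono) (auto simp: ext_nonneg ext_upper C_nonneg h_le B)
  show "AE w in lborel \<Otimes>\<^sub>M lborel. norm ((ext a (fst w) * ext b (snd w)) *\<^sub>R h w)
      \<le> norm (C * C * B * indicator (I \<times> I) w)"
  proof (rule AE_I2)
    fix w :: "real \<times> real"
    show "norm ((ext a (fst w) * ext b (snd w)) *\<^sub>R h w) \<le> norm (C * C * B * indicator (I \<times> I) w)"
    proof (cases "w \<in> I \<times> I")
      case True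
      with * show ?thesis by (simp add: abs_mult ext_nonneg C_nonneg B)
    next
      case False
      then have "ext a (fst w) * ext b (snd w) = 0" by (auto simp: ext_def mem_Times_iff)
      then show ?thesis by auto
    qed
  qed
qed measurable

text \<open>Valid for every real a, since \<open>ext a\<close> has mass 1 or 0. This matters because
  Fubini is applied over all paths, including those that leave \<open>I\<close>.\<close>

lemma norm_ext_integral_le:
  fixes f :: "real \<Rightarrow> complex"
  assumes [measurable]: "f \<in> borel_measurable borel" and le: "\<And>u. norm (f u) \<le> B"
  shows "norm (\<integral>u. ext a u *\<^sub>R f u \<partial>lborel) \<le> B"
proof -
  have B: "0 \<le> B" using le[of undefined] norm_ge_zero order_trans by blast
  have "norm (\<integral>u. ext a u *\<^sub>R f u \<partial>lborel) \<le> (\<integral>u. norm (ext a u *\<^sub>R f u) \<partial>lborel)"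
    by (rule integral_norm_bound)
  also have "\<dots> \<le> (\<integral>u. ext a u * B \<partial>lborel)"
    by (rule integral_mono_AE')
       (auto intro!: integrable_mult_left ext_integrable mult_left_mono le simp: ext_nonneg B)
  also have "\<dots> \<le> B" using ext_total_le[of a] mult_right_mono[OF ext_total_le B] by simp
  finally show ?thesis .
qed

lemma ext_product_integral:
  fixes h :: "real \<times> real \<Rightarrow> complex"
  assumes h [measurable]: "h \<in> borel_measurable (borel \<Otimes>\<^sub>M borel)" and h_le: "\<And>w. norm (h w) \<le> B"
  shows "(\<integral>w. (ext a (fst w) * ext b (snd w)) *\<^sub>R h w \<partial>(lborel \<Otimes>\<^sub>M lborel)) =
    (\<integral>v. ext b v *\<^sub>R (\<integral>u. ext a u *\<^sub>R h (u, v) \<partial>lborel) \<partial>lborel)" (is ?eq)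
  and "norm (\<integral>w. (ext a (fst w) * ext b (snd w)) *\<^sub>R h w \<partial>(lborel \<Otimes>\<^sub>M lborel)) \<le> B"
proof -
  have "(\<integral>w. (ext a (fst w) * ext b (snd w)) *\<^sub>R h w \<partial>(lborel \<Otimes>\<^sub>M lborel)) =
       (\<integral>v. \<integral>u. (ext a u * ext b v) *\<^sub>R h (u, v) \<partial>lborel \<partial>lborel)"
    using ext_product_integrable[OF h h_le, of a b]
    by (subst lborel_pair.integral_snd) (auto simp: case_prod_unfold)
  then show ?eq
    by (simp flip: integral_scaleR_right) (simp add: mult_ac)
  show "norm (\<integral>w. (ext a (fst w) * ext b (snd w)) *\<^sub>R h w \<partial>(lborel \<Otimes>\<^sub>M lborel)) \<le> B"
    unfolding \<open>?eq\<close> by (intro norm_ext_integral_le) (auto simp: h_le)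
qed

end

section \<open>The Markov property of one chain\<close>

locale chain = prob_space M + bounded_density I p c C
  for M :: "'a measure" and I p c C +
  fixes X :: "nat \<Rightarrow> 'a \<Rightarrow> real"
  assumes markov: "markov_chain M I p X"
begin

lemma X_measurable [measurable]: "X n \<in> borel_measurable M"
  using markov by (simp add: markov_chain_def)

lemma X_in: "\<omega> \<in> space M \<Longrightarrow> X n \<omega> \<in> I"
  using markov by (simp add: markov_chain_def)

lemma cond_prob:
  "A \<in> sets borel \<Longrightarrow> A \<subseteq> I \<Longrightarrow>
     AE \<omega> in M. real_cond_exp M (natural_filtration M X n) (indicator (X (Suc n) -` A \<inter> space M)) \<omega>
       = (LINT y:A|lborel. p (X n \<omega>) y)"
  using markov by (simp add: markov_chain_def)

lemma joint_law_rectangle: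
  assumes A [measurable]: "A \<in> sets path_space" and B [measurable]: "B \<in> sets borel"
  shows "emeasure M {\<omega>\<in>space M. stopped n (trajectory X \<omega>) \<in> A \<and> X (Suc n) \<omega> \<in> B} =
    (\<integral>\<^sup>+\<omega>. indicator A (stopped n (trajectory X \<omega>)) *
       (\<integral>\<^sup>+u. ext (X n \<omega>) u * indicator B u \<partial>lborel) \<partial>M)"
proof -
  let ?F = "natural_filtration M X n"
  let ?T = "\<lambda>\<omega>. stopped n (trajectory X \<omega>)"
  \<comment> \<open>The Markov condition covers only subsets of \<open>I\<close>; intersecting
    \<open>B\<close> with \<open>I\<close> changes no event because the chain stays in
    \<open>I\<close>.\<close>
  let ?G = "X (Suc n) -` (B \<inter> I) \<inter> space M"
  let ?J = "\<lambda>\<omega>. \<integral>u. ext (X n \<omega>) u * indicator B u \<partial>lborel"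
  interpret finite_measure_subalgebra M ?F
    by unfold_locales (rule subalgebra_natural_filtration, measurable)
  define E where "E = ?T -` A \<inter> space M"
  have EF: "E \<in> sets ?F"
    unfolding E_def using measurable_sets[OF stopped_trajectory_adapted A] space_natural_filtration
    by metis
  have E [measurable]: "E \<in> sets M"
    using EF subalg by (auto simp: subalgebra_def)
  have G [measurable]: "?G \<in> sets M" by measurable
  have J: "?J \<omega> = (LINT y:B \<inter> I|lborel. p (X n \<omega>) y)" if "\<omega> \<in> space M" for \<omega>
    unfolding set_lebesgue_integral_def using X_in[OF that, of n]
    by (intro Bochner_Integration.integral_cong) (auto simp: ext_def split: split_indicator)
  have J_meas [measurable]: "?J \<in> borel_measurable M"
    by (rule lborel.borel_measurable_lebesgue_integral) measurable
  have J_nonneg: "0 \<le> ?J \<omega>" for \<omega>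
    by (rule integral_nonneg_AE) (simp add: ext_nonneg)
  have J_le: "?J \<omega> \<le> 1" for \<omega>
  proof -
    have "?J \<omega> \<le> (\<integral>u. ext (X n \<omega>) u \<partial>lborel)"
      by (rule integral_mono) (auto intro!: integrable_real_mult_indicator ext_integrable
        simp: ext_nonneg split: split_indicator)
    with ext_total_le[of "X n \<omega>"] show ?thesis by linarith
  qed
  have cond: "AE \<omega> in M. real_cond_exp M ?F (indicator ?G) \<omega> = (LINT y:B \<inter> I|lborel. p (X n \<omega>) y)"
    by (rule cond_prob) auto
  have "{\<omega>\<in>space M. ?T \<omega> \<in> A \<and> X (Suc n) \<omega> \<in> B} = E \<inter> ?G"
    using X_in by (auto simp: E_def)
  moreover have "measure M (E \<inter> ?G) = (\<integral>\<omega>. indicator E \<omega> * ?J \<omega> \<partial>M)"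
  proof -
    have "measure M (E \<inter> ?G) = (\<integral>\<omega>\<in>E. indicator ?G \<omega> \<partial>M)"
      by (simp add: set_lebesgue_integral_def indicator_inter_arith[symmetric])
    also have "\<dots> = (\<integral>\<omega>\<in>E. real_cond_exp M ?F (indicator ?G) \<omega> \<partial>M)"
      by (rule real_cond_exp_intA[OF _ EF]) (auto simp: emeasure_eq_measure)
    also have "\<dots> = (\<integral>\<omega>. indicator E \<omega> * ?J \<omega> \<partial>M)"
      unfolding set_lebesgue_integral_def
      by (rule integral_cong_AE; (measurable; fail)?)
         (use cond AE_space in \<open>eventually_elim, auto simp: J\<close>)
    finally show ?thesis .
  qed
  moreover have "(\<integral>\<^sup>+\<omega>. indicator A (?T \<omega>) *
       (\<integral>\<^sup>+u. ext (X n \<omega>) u * indicator B u \<partial>lborel) \<partial>M) = (\<integral>\<^sup>+\<omega>. ennreal (indicator E \<omega> * ?J \<omega>) \<partial>M)"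
    by (rule nn_integral_cong) (auto simp: E_def nn_integral_ext split: split_indicator)
  moreover have "\<dots> = ennreal (\<integral>\<omega>. indicator E \<omega> * ?J \<omega> \<partial>M)"
    by (rule nn_integral_eq_integral)
       (auto intro!: integrable_const_bound[where B=1] AE_I2 simp: J_nonneg J_le abs_mult split: split_indicator)
  ultimately show ?thesis by (simp add: emeasure_eq_measure)
qed

text \<open>Rectangles generate the product and are stable under intersection. Written as a density
  over history times Lebesgue measure, the joint law gives the Markov property for bounded functions
  of past and next state by Fubini.\<close>

lemma joint_law:
  "distr M (path_space \<Otimes>\<^sub>M lborel) (\<lambda>\<omega>. (stopped n (trajectory X \<omega>), X (Suc n) \<omega>)) =
   density (distr M path_space (\<lambda>\<omega>. stopped n (trajectory X \<omega>)) \<Otimes>\<^sub>M lborel) (\<lambda>z. ext (fst z n) (snd z))"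
  (is "?L = ?R")
proof (rule measure_eqI_generator_eq[OF Int_stable_pair_measure_generator[of path_space "lborel :: real measure"]])
  let ?E = "{a \<times> b | a b. a \<in> sets path_space \<and> b \<in> sets (lborel :: real measure)}"
  let ?\<Omega> = "space path_space \<times> space (lborel :: real measure)"
  let ?T = "\<lambda>\<omega>. stopped n (trajectory X \<omega>)"
  interpret T: prob_space "distr M path_space ?T" by (rule prob_space_distr) measurable
  show "?E \<subseteq> Pow ?\<Omega>" by (auto dest: sets.sets_into_space)
  show "sets ?L = sigma_sets ?\<Omega> ?E" "sets ?R = sigma_sets ?\<Omega> ?E"
    by (auto simp: sets_pair_measure space_PiM)
  \<comment> \<open>The whole space is itself a rectangle of finite mass, so a constant sequence
    exhausts it.\<close>
  have "?\<Omega> \<in> ?E" by (blast intro: sets.top)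
  then show "range (\<lambda>_::nat. ?\<Omega>) \<subseteq> ?E" "(\<Union>i::nat. ?\<Omega>) = ?\<Omega>" by auto
  interpret L: prob_space ?L by (rule prob_space_distr) measurable
  show "emeasure ?L ?\<Omega> \<noteq> \<infinity>" by simp
  fix Z :: "((nat \<Rightarrow> real) \<times> real) set" assume "Z \<in> ?E"
  then obtain A B where Z: "Z = A \<times> B" and A [measurable]: "A \<in> sets path_space"
    and B [measurable]: "B \<in> sets borel" by auto
  have "emeasure ?R Z = (\<integral>\<^sup>+z. ext (fst z n) (snd z) * indicator (A \<times> B) z
      \<partial>(distr M path_space ?T \<Otimes>\<^sub>M lborel))"
    unfolding Z by (subst emeasure_density)
      (auto intro!: nn_integral_cong simp: ext_nonneg split: split_indicator)
  also have "\<dots> = (\<integral>\<^sup>+x. \<integral>\<^sup>+u. ext (x n) u * indicator (A \<times> B) (x, u) \<partial>lborel \<partial>distr M path_space ?T)"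
    by (subst lborel.nn_integral_fst[symmetric]) auto
  also have "\<dots> = (\<integral>\<^sup>+x. indicator A x * (\<integral>\<^sup>+u. ext (x n) u * indicator B u \<partial>lborel) \<partial>distr M path_space ?T)"
    by (intro nn_integral_cong, rename_tac x, case_tac "x \<in> A") (auto simp: indicator_times)
  also have "\<dots> = (\<integral>\<^sup>+\<omega>. indicator A (?T \<omega>) * (\<integral>\<^sup>+u. ext (?T \<omega> n) u * indicator B u \<partial>lborel) \<partial>M)"
    by (rule nn_integral_distr) measurable
  also have "\<dots> = emeasure M {\<omega>\<in>space M. ?T \<omega> \<in> A \<and> X (Suc n) \<omega> \<in> B}"
    by (subst joint_law_rectangle) (auto simp: stopped_apply trajectory_def)
  also have "\<dots> = emeasure ?L Z"
    unfolding Z by (subst emeasure_distr) (auto intro!: arg_cong[where f="emeasure M"])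
  finally show "emeasure ?L Z = emeasure ?R Z" ..
qed

definition path_law :: "(nat \<Rightarrow> real) measure" where
  "path_law = distr M path_space (trajectory X)"

lemma sets_path_law [measurable_cong]: "sets path_law = sets path_space"
  by (simp add: path_law_def)

sublocale path: prob_space path_law
  unfolding path_law_def by (rule prob_space_distr) measurable

lemma markov_integral:
  fixes K :: "(nat \<Rightarrow> real) \<Rightarrow> real \<Rightarrow> complex"
  assumes K [measurable]: "case_prod K \<in> borel_measurable (path_space \<Otimes>\<^sub>M borel)"
    and K_le: "\<And>x u. norm (K x u) \<le> B"
  shows "(\<integral>x. K (stopped n x) (x (Suc n)) \<partial>path_law) =
    (\<integral>x. \<integral>u. ext (x n) u *\<^sub>R K (stopped n x) u \<partial>lborel \<partial>path_law)"
proof -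
  let ?T = "\<lambda>\<omega>. stopped n (trajectory X \<omega>)"
  let ?D = "distr M path_space ?T"
  let ?L = "distr M (path_space \<Otimes>\<^sub>M lborel) (\<lambda>\<omega>. (?T \<omega>, X (Suc n) \<omega>))"
  interpret T: prob_space ?D by (rule prob_space_distr) measurable
  interpret L: prob_space ?L by (rule prob_space_distr) measurable
  interpret TL: pair_sigma_finite ?D lborel by unfold_locales
  have "integrable ?L (case_prod K)"
    by (rule L.integrable_const_bound[where B=B]) (auto simp: K_le case_prod_unfold)
  then have int: "integrable (?D \<Otimes>\<^sub>M lborel) (\<lambda>z. ext (fst z n) (snd z) *\<^sub>R case_prod K z)"
    unfolding joint_law by (subst (asm) integrable_density) (auto simp: ext_nonneg)
  have "(\<integral>x. K (stopped n x) (x (Suc n)) \<partial>path_law) = (\<integral>\<omega>. K (?T \<omega>) (X (Suc n) \<omega>) \<partial>M)"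
    unfolding path_law_def by (subst integral_distr) (auto simp: trajectory_def)
  also have "\<dots> = (\<integral>z. case_prod K z \<partial>?L)"
    by (subst integral_distr) auto
  also have "\<dots> = (\<integral>z. ext (fst z n) (snd z) *\<^sub>R case_prod K z \<partial>(?D \<Otimes>\<^sub>M lborel))"
    unfolding joint_law by (subst integral_density) (auto simp: ext_nonneg)
  also have "\<dots> = (\<integral>x. \<integral>u. ext (x n) u *\<^sub>R K x u \<partial>lborel \<partial>?D)"
    using TL.integral_fst'[OF int] by simp
  also have "\<dots> = (\<integral>\<omega>. \<integral>u. ext (?T \<omega> n) u *\<^sub>R K (?T \<omega>) u \<partial>lborel \<partial>M)"
    by (rule integral_distr) measurable
  also have "\<dots> = (\<integral>x. \<integral>u. ext (x n) u *\<^sub>R K (stopped n x) u \<partial>lborel \<partial>path_law)"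
    unfolding path_law_def by (subst integral_distr) (auto simp: stopped_apply)
  finally show ?thesis .
qed

text \<open>Under the product law the paths can be advanced one at a time: with y fixed the Markov
  property moves x, and after an exchange of the integrals it moves y.\<close>

lemma pair_markov_integral:
  fixes F :: "(nat \<Rightarrow> real) \<Rightarrow> (nat \<Rightarrow> real) \<Rightarrow> complex" and h :: "real \<times> real \<Rightarrow> complex"
  assumes F [measurable]: "case_prod F \<in> borel_measurable (path_space \<Otimes>\<^sub>M path_space)"
    and F_le: "\<And>x y. norm (F x y) \<le> 1"
    and h [measurable]: "h \<in> borel_measurable (borel \<Otimes>\<^sub>M borel)" and h_le: "\<And>w. norm (h w) \<le> B"
  shows "(\<integral>z. F (stopped n (fst z)) (stopped n (snd z)) * h (fst z (Suc n), snd z (Suc n)) \<partial>(path_law \<Otimes>\<^sub>M path_law)) =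
    (\<integral>z. F (stopped n (fst z)) (stopped n (snd z)) *
      (\<integral>w. (ext (fst z n) (fst w) * ext (snd z n) (snd w)) *\<^sub>R h w \<partial>(lborel \<Otimes>\<^sub>M lborel)) \<partial>(path_law \<Otimes>\<^sub>M path_law))"
proof -
  interpret PP: pair_prob_space path_law path_law by unfold_locales
  let ?P = "path_law \<Otimes>\<^sub>M path_law"
  let ?G = "\<lambda>x y u v. F (stopped n x) (stopped n y) * h (u, v)"
  have B: "0 \<le> B" using h_le[of undefined] norm_ge_zero order_trans by blast
  have [measurable]: "y \<in> space path_space" for y by (simp add: space_PiM)
  have G_le: "norm (F x y * h (u, v)) \<le> B" for x y u v
    using mult_mono[OF F_le[of x y] h_le[of "(u, v)"]] B by (simp add: norm_mult)
  have 1: "integrable ?P (\<lambda>(x, y). ?G x y (x (Suc n)) (y (Suc n)))"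
    by (rule PP.integrable_const_bound[where B=B]) (auto simp: G_le case_prod_unfold)
  \<comment> \<open>The integrand between the two moves: x is already averaged over its next
    position, y is not. The exchange of integrals is applied to it.\<close>
  have 2: "integrable ?P (\<lambda>(x, y). \<integral>u. ext (x n) u *\<^sub>R ?G x y u (y (Suc n)) \<partial>lborel)"
  proof (rule PP.integrable_const_bound[where B=B])
    show "AE z in ?P. norm (case z of (x, y) \<Rightarrow> \<integral>u. ext (x n) u *\<^sub>R ?G x y u (y (Suc n)) \<partial>lborel) \<le> B"
      unfolding split_beta by (intro AE_I2 norm_ext_integral_le) (auto simp: G_le)
  qed measurable
  have 3: "integrable ?P (\<lambda>(x, y). F (stopped n x) (stopped n y) *
      (\<integral>w. (ext (x n) (fst w) * ext (y n) (snd w)) *\<^sub>R h w \<partial>(lborel \<Otimes>\<^sub>M lborel)))"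
  proof (rule PP.integrable_const_bound[where B=B])
    show "AE z in ?P. norm (case z of (x, y) \<Rightarrow> F (stopped n x) (stopped n y) *
      (\<integral>w. (ext (x n) (fst w) * ext (y n) (snd w)) *\<^sub>R h w \<partial>(lborel \<Otimes>\<^sub>M lborel))) \<le> B"
      unfolding split_beta norm_mult
      using mult_mono[OF F_le ext_product_integral(2)[OF h h_le]] B by (intro AE_I2) simp
  qed measurable
  have "(\<integral>z. F (stopped n (fst z)) (stopped n (snd z)) * h (fst z (Suc n), snd z (Suc n)) \<partial>?P) =
      (\<integral>y. \<integral>x. ?G x y (x (Suc n)) (y (Suc n)) \<partial>path_law \<partial>path_law)"
    by (subst PP.integral_snd[OF 1]) (simp add: case_prod_unfold)
  also have "\<dots> = (\<integral>y. \<integral>x. \<integral>u. ext (x n) u *\<^sub>R ?G x y u (y (Suc n)) \<partial>lborel \<partial>path_law \<partial>path_law)"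
    by (subst markov_integral[where K="\<lambda>x u. F x (stopped n y) * h (u, y (Suc n))" and B=B for y])
       (auto simp: G_le)
  also have "\<dots> = (\<integral>x. \<integral>y. \<integral>u. ext (x n) u *\<^sub>R ?G x y u (y (Suc n)) \<partial>lborel \<partial>path_law \<partial>path_law)"
    by (rule PP.Fubini_integral[OF 2])
  also have "\<dots> = (\<integral>x. \<integral>y. \<integral>v. ext (y n) v *\<^sub>R (\<integral>u. ext (x n) u *\<^sub>R ?G x y u v \<partial>lborel) \<partial>lborel \<partial>path_law \<partial>path_law)"
    by (subst markov_integral[where B=B and
          K="\<lambda>y v. \<integral>u. ext (x n) u *\<^sub>R (F (stopped n x) y * h (u, v)) \<partial>lborel" for x])
       (auto intro!: norm_ext_integral_le simp: G_le)
  also have "\<dots> = (\<integral>x. \<integral>y. F (stopped n x) (stopped n y) *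
      (\<integral>w. (ext (x n) (fst w) * ext (y n) (snd w)) *\<^sub>R h w \<partial>(lborel \<Otimes>\<^sub>M lborel)) \<partial>path_law \<partial>path_law)"
  proof (intro Bochner_Integration.integral_cong refl)
    fix x y
    show "(\<integral>v. ext (y n) v *\<^sub>R (\<integral>u. ext (x n) u *\<^sub>R ?G x y u v \<partial>lborel) \<partial>lborel) =
        F (stopped n x) (stopped n y) *
          (\<integral>w. (ext (x n) (fst w) * ext (y n) (snd w)) *\<^sub>R h w \<partial>(lborel \<Otimes>\<^sub>M lborel))"
      unfolding ext_product_integral(1)[OF h h_le]
      by (simp only: mult_scaleR_right[symmetric] integral_mult_right_zero)
  qed
  also have "\<dots> = (\<integral>z. F (stopped n (fst z)) (stopped n (snd z)) *
      (\<integral>w. (ext (fst z n) (fst w) * ext (snd z n) (snd w)) *\<^sub>R h w \<partial>(lborel \<Otimes>\<^sub>M lborel)) \<partial>?P)"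
    by (subst PP.integral_fst[OF 3]) (simp add: case_prod_unfold)
  finally show ?thesis .
qed

end

section \<open>Convergence of the characteristic functions\<close>

text \<open>As |exp x| = exp (Re x) \<le> 1, both bases lie in the unit disc, so the n-th powers
  differ by at most n times the distance of the bases, a second-order Taylor remainder.\<close>

lemma power_near_exp:
  fixes x :: complex
  assumes "norm (1 + x) \<le> 1" "Re x \<le> 0"
  shows "norm ((1 + x) ^ n - exp (of_nat n * x)) \<le> real n * (exp (norm x) * (norm x)\<^sup>2)"
proof -
  have "norm ((1 + x) ^ n - exp x ^ n) \<le> real n * norm (1 + x - exp x)"
    by (rule norm_power_diff) (use assms in auto)
  also have "norm (1 + x - exp x) \<le> exp (norm x) * (norm x)\<^sup>2"
    using Taylor_exp_field[of x 1] by (simp add: norm_minus_commute numeral_2_eq_2)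
  finally show ?thesis by (simp add: exp_of_nat_mult mult_left_mono)
qed

text \<open>For fixed m the total error bound tends to 4 t r^m, so m is chosen before n. The
  exponent carries \<open>Suc\<close> because times 0 to N are counted inclusively.\<close>

lemma poisson_limit_of_bounds:
  fixes A :: "nat \<Rightarrow> complex" and e :: "nat \<Rightarrow> real" and s :: complex
  assumes s: "norm s = 1" and t: "0 < t" and r: "0 \<le> r" "r < 1" and K: "0 \<le> K"
    and e: "e \<longlonglongrightarrow> 0" and pos: "eventually (\<lambda>n. 0 < e n) sequentially"
    and A: "\<And>m. eventually (\<lambda>n. norm (A n - (1 + (s - 1) * of_real (e n)) ^ Suc (nat \<lfloor>t / e n\<rfloor>))
      \<le> real (Suc (nat \<lfloor>t / e n\<rfloor>)) * (2 * e n * (4 * real m * K * e n + 2 * r ^ m))) sequentially"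
  shows "A \<longlonglongrightarrow> exp (of_real t * (s - 1))"
proof -
  define N where "N = (\<lambda>n. Suc (nat \<lfloor>t / e n\<rfloor>))"
  define a where "a = (\<lambda>n. real (N n) * e n)"
  \<comment> \<open>For u = t / e, the integer floor(u) + 1 lies between u and u + 1; multiply by
    e.\<close>
  have a_bounds: "eventually (\<lambda>n. t \<le> a n \<and> a n \<le> t + e n) sequentially"
    using pos
  proof eventually_elim
    case (elim n)
    have "0 \<le> t / e n" using t elim by simp
    then have "real (nat \<lfloor>t / e n\<rfloor>) \<le> t / e n" "t / e n \<le> real (nat \<lfloor>t / e n\<rfloor>) + 1"
      by linarith+
    with elim show ?case unfolding a_def N_def by (simp add: field_simps)
  qed
  have a: "a \<longlonglongrightarrow> t"
  proof (rule tendsto_sandwich[where f="\<lambda>_. t" and h="\<lambda>n. t + e n"])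
    show "(\<lambda>n. t + e n) \<longlonglongrightarrow> t" using tendsto_add[OF tendsto_const e] by simp
  qed (use a_bounds in \<open>auto elim: eventually_mono\<close>)
  let ?x = "\<lambda>n. (s - 1) * complex_of_real (e n)"
  have s2: "norm (s - 1) \<le> 2" using norm_triangle_ineq4[of s 1] s by simp
  have "(\<lambda>n. A n - (1 + ?x n) ^ N n) \<longlonglongrightarrow> 0"
  proof (rule tendstoI)
    fix h :: real assume h: "0 < h"
    have "(\<lambda>m. t * (4 * r ^ m)) \<longlonglongrightarrow> t * (4 * 0)"
      by (intro tendsto_intros) (use r in auto)
    then have "eventually (\<lambda>m. t * (4 * r ^ m) < h) sequentially"
      using h by (intro order_tendstoD(2)) auto
    then obtain m where m: "t * (4 * r ^ m) < h" by (auto simp: eventually_sequentially)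
    have "(\<lambda>n. a n * (2 * (4 * real m * K * e n + 2 * r ^ m))) \<longlonglongrightarrow> t * (2 * (4 * real m * K * 0 + 2 * r ^ m))"
      by (intro tendsto_intros a e)
    then have "eventually (\<lambda>n. a n * (2 * (4 * real m * K * e n + 2 * r ^ m)) < h) sequentially"
      using m by (intro order_tendstoD(2)) auto
    with A[of m] show "eventually (\<lambda>n. dist (A n - (1 + ?x n) ^ N n) 0 < h) sequentially"
      by eventually_elim (simp add: a_def N_def mult_ac)
  qed
  moreover have "(\<lambda>n. (1 + ?x n) ^ N n - exp (of_nat (N n) * ?x n)) \<longlonglongrightarrow> 0"
  proof (rule Lim_null_comparison)
    have "eventually (\<lambda>n. e n < 1) sequentially"
      using e by (intro order_tendstoD(2)) auto
    with pos show "eventually (\<lambda>n. norm ((1 + ?x n) ^ N n - exp (of_nat (N n) * ?x n))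
        \<le> exp 2 * (4 * a n * e n)) sequentially"
    proof eventually_elim
      case (elim n)
      have "1 + ?x n = of_real (1 - e n) + s * of_real (e n)" by (simp add: algebra_simps)
      also have "norm \<dots> \<le> \<bar>1 - e n\<bar> + e n"
        using elim by (intro order_trans[OF norm_triangle_ineq]) (simp only: norm_mult s norm_of_real; simp)
      finally have 1: "norm (1 + ?x n) \<le> 1" using elim by simp
      have "Re s \<le> 1" using complex_Re_le_cmod[of s] s by simp
      then have 2: "Re (?x n) \<le> 0" using elim by (simp add: mult_nonpos_nonneg)
      have 3: "norm (?x n) \<le> 2 * e n" using s2 elim by (simp add: norm_mult mult_right_mono)
      \<comment> \<open>Here e < 1 turns 2 e into the exponent 2. Multiplying by \<open>N n\<close>
        then absorbs one factor e into the convergent \<open>a n\<close> and leaves the other to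
        tend to 0.\<close>
      have "exp (norm (?x n)) * (norm (?x n))\<^sup>2 \<le> exp 2 * (2 * e n)\<^sup>2"
        using 3 elim by (intro mult_mono power_mono) auto
      then have "real (N n) * (exp (norm (?x n)) * (norm (?x n))\<^sup>2) \<le> real (N n) * (exp 2 * (2 * e n)\<^sup>2)"
        by (rule mult_left_mono) simp
      also have "\<dots> = exp 2 * (4 * a n * e n)" by (simp add: a_def power2_eq_square)
      finally show ?case using power_near_exp[OF 1 2, of "N n"] by linarith
    qed
    have "(\<lambda>n. exp 2 * (4 * a n * e n)) \<longlonglongrightarrow> exp 2 * (4 * t * 0)"
      by (intro tendsto_intros a e)
    then show "(\<lambda>n. exp 2 * (4 * a n * e n)) \<longlonglongrightarrow> 0" by simp
  qed
  moreover have "(\<lambda>n. exp (of_nat (N n) * ?x n)) \<longlonglongrightarrow> exp (of_real t * (s - 1))"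
  proof -
    have "(\<lambda>n. exp (of_real (a n) * (s - 1))) \<longlonglongrightarrow> exp (of_real t * (s - 1))"
      by (intro tendsto_intros a)
    then show ?thesis by (simp add: a_def mult_ac)
  qed
  ultimately have "(\<lambda>n. (A n - (1 + ?x n) ^ N n) + ((1 + ?x n) ^ N n - exp (of_nat (N n) * ?x n))
      + exp (of_nat (N n) * ?x n)) \<longlonglongrightarrow> 0 + 0 + exp (of_real t * (s - 1))"
    by (intro tendsto_add)
  then show ?thesis by simp
qed

text \<open>The series against the point masses is exp (-t) times the exponential series of t exp (i
  \<theta>).\<close>

lemma char_poisson:
  assumes "0 < t"
  shows "char (distr (measure_pmf (poisson_pmf t)) borel real) \<theta> = exp (of_real t * (iexp \<theta> - 1))"
proof -
  let ?P = "measure_pmf (poisson_pmf t)"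
  let ?f = "\<lambda>k. iexp (\<theta> * real k)"
  have "integrable ?P ?f"
    by (rule measure_pmf.integrable_const_bound[where B=1]) auto
  then have int: "integrable (count_space UNIV) (\<lambda>k. pmf (poisson_pmf t) k *\<^sub>R ?f k)"
    by (simp add: measure_pmf_eq_density integrable_density)
  have "char (distr ?P borel real) \<theta> = (\<integral>k. ?f k \<partial>?P)"
    by (simp add: char_def integral_distr)
  also have "\<dots> = (\<integral>k. pmf (poisson_pmf t) k *\<^sub>R ?f k \<partial>count_space UNIV)"
    by (subst measure_pmf_eq_density) (simp add: integral_density)
  finally have char: "(\<lambda>k. pmf (poisson_pmf t) k *\<^sub>R ?f k) sums char (distr ?P borel real) \<theta>"
    using sums_integral_count_space_nat[OF int] by simp
  have "(\<lambda>k. exp (- of_real t) * ((of_real t * iexp \<theta>) ^ k /\<^sub>R fact k)) sums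
      (exp (- of_real t) * exp (of_real t * iexp \<theta>))"
    by (intro sums_mult exp_converges)
  also have "(\<lambda>k. exp (- of_real t) * ((of_real t * iexp \<theta>) ^ k /\<^sub>R fact k)) =
      (\<lambda>k. pmf (poisson_pmf t) k *\<^sub>R ?f k)"
    using assms
    by (auto simp: fun_eq_iff power_mult_distrib scaleR_conv_of_real exp_of_nat_mult[symmetric]
        exp_of_real[symmetric] field_simps)
  finally show ?thesis
    using sums_unique2[OF char] by (simp add: exp_add[symmetric] algebra_simps)
qed

section \<open>The stationary pair chain as a Doeblin kernel\<close>

locale pair_chain = chain M I p c C X
  for M :: "'a measure" and I p c C and X :: "nat \<Rightarrow> 'a \<Rightarrow> real" +
  assumes stat: "stationary M X"
begin

definition marg :: "real measure" where
  "marg = distr path_law borel (\<lambda>x. x 0)"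

lemma sets_marg [measurable_cong]: "sets marg = sets borel"
  by (simp add: marg_def)

sublocale marg: prob_space marg
  unfolding marg_def by (rule path.prob_space_distr) measurable

lemma coordinate_law: "distr path_law borel (\<lambda>x. x k) = distr M borel (X k)"
  unfolding path_law_def by (subst distr_distr) (auto simp: trajectory_def comp_def)

text \<open>Stationarity enters here, as equality of the laws at times 0 and 1; together with one
  Markov step this makes the product marginal invariant.\<close>

lemma marg_Suc_0: "distr path_law borel (\<lambda>x. x (Suc 0)) = marg"
proof -
  have "distr M borel (X (Suc 0)) = distr (distr M path_space (trajectory (\<lambda>n. X (Suc n)))) borel (\<lambda>x. x 0)"
    by (subst distr_distr) (auto simp: trajectory_def comp_def)
  also have "\<dots> = distr path_law borel (\<lambda>x. x 0)"
    using stat by (simp add: stationary_def path_law_def)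
  finally show ?thesis by (simp add: coordinate_law marg_def)
qed

lemma AE_path_in: "AE x in path_law. x k \<in> I"
proof -
  have "AE x in distr M borel (X k). x \<in> I"
    by (subst AE_distr_iff) (auto simp: X_in)
  then have "AE x in distr path_law borel (\<lambda>x. x k). x \<in> I" unfolding coordinate_law .
  then show ?thesis by (subst (asm) AE_distr_iff) auto
qed

text \<open>The copy \<open>Y\<close> takes values in \<open>I\<close> only almost surely, so the pair chain is studied under
  the product of the path laws and its stationary law is restricted to \<open>I \<times> I\<close>.\<close>

abbreviation "PP \<equiv> path_law \<Otimes>\<^sub>M path_law"
abbreviation "ref_meas \<equiv> restrict_space (lborel \<Otimes>\<^sub>M lborel) (I \<times> I)"
abbreviation "inv_meas \<equiv> restrict_space (marg \<Otimes>\<^sub>M marg) (I \<times> I)"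
abbreviation "dens \<equiv> \<lambda>z w. ext (fst z) (fst w) * ext (snd z) (snd w)"
abbreviation (input) "pos k z \<equiv> (fst z k, snd z k)"

sublocale PP: pair_prob_space path_law path_law by unfold_locales

lemma I2 [measurable]: "I \<times> I \<in> sets (borel \<Otimes>\<^sub>M borel)"
  by measurable

lemma I2_lborel: "I \<times> I \<in> sets (lborel \<Otimes>\<^sub>M lborel)"
  by (rule pair_measureI) simp_all

lemma I2_marg: "I \<times> I \<in> sets (marg \<Otimes>\<^sub>M marg)"
  by (rule pair_measureI) (simp_all add: sets_marg)

lemma sets_ref: "sets ref_meas = sets (restrict_space (borel \<Otimes>\<^sub>M borel) (I \<times> I))"
  by (intro sets_restrict_space_cong sets_pair_measure_cong) auto

lemma space_ref: "space ref_meas = I \<times> I"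
  by (simp add: space_restrict_space space_pair_measure)

lemma space_inv: "space inv_meas = I \<times> I"
  by (simp add: space_restrict_space space_pair_measure sets_eq_imp_space_eq[OF sets_marg])

lemma AE_PP_in: "AE z in PP. pos k z \<in> I \<times> I"
proof -
  have "{z \<in> space PP. pos k z \<in> I \<times> I} \<in> sets PP" by measurable
  moreover have "AE x in path_law. AE y in path_law. pos k (x, y) \<in> I \<times> I"
    using AE_path_in[of k] AE_path_in[of k] by (auto elim: eventually_mono)
  ultimately show ?thesis by (rule PP.AE_pair_measure)
qed

lemma coordinate_pair_law:
  assumes "k \<in> {0, Suc 0}"
  shows "distr PP (borel \<Otimes>\<^sub>M borel) (\<lambda>z. pos k z) = marg \<Otimes>\<^sub>M marg"
proof -
  have m: "distr path_law borel (\<lambda>x. x k) = marg" using assms marg_Suc_0 marg_def by auto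
  show ?thesis
    using pair_measure_distr[of "\<lambda>x. x k" path_law borel "\<lambda>x. x k" path_law borel]
    by (simp add: m marg.sigma_finite_measure_axioms case_prod_unfold)
qed

lemma coordinate_integral:
  fixes f :: "real \<times> real \<Rightarrow> complex"
  assumes [measurable]: "f \<in> borel_measurable (borel \<Otimes>\<^sub>M borel)"
    and k: "k \<in> {0, Suc 0}"
  shows "(\<integral>z. f (pos k z) \<partial>PP) = (\<integral>w. f w \<partial>(marg \<Otimes>\<^sub>M marg))"
proof -
  show ?thesis
    by (subst coordinate_pair_law[OF k, symmetric], subst integral_distr) auto
qed

text \<open>The abstract kernel sees functions on I \<times> I only. The indicator turns them into
  Borel functions on the plane, where the Markov identity is available.\<close>

lemma extend_measurable:
  fixes h :: "real \<times> real \<Rightarrow> complex"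
  assumes "h \<in> borel_measurable ref_meas"
  shows "(\<lambda>w. indicator (I \<times> I) w *\<^sub>R h w) \<in> borel_measurable (borel \<Otimes>\<^sub>M borel)"
  using assms I2
  by (subst (asm) measurable_cong_sets[OF sets_ref refl])
     (simp add: borel_measurable_restrict_space_iff space_pair_measure)

lemma trans_integral_eq:
  fixes h :: "real \<times> real \<Rightarrow> complex"
  shows "(\<integral>w. dens z w *\<^sub>R h w \<partial>ref_meas) = (\<integral>w. dens z w *\<^sub>R (indicator (I \<times> I) w *\<^sub>R h w) \<partial>(lborel \<Otimes>\<^sub>M lborel))"
  by (subst integral_restrict_space) (auto simp: mult_ac space_pair_measure)

text \<open>Off I \<times> I the density vanishes identically, so the integral is already 0
  there.\<close>

lemma trans_integral_outside:
  fixes h :: "real \<times> real \<Rightarrow> complex"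
  shows "indicator (I \<times> I) z *\<^sub>R (\<integral>w. dens z w *\<^sub>R h w \<partial>ref_meas) = (\<integral>w. dens z w *\<^sub>R h w \<partial>ref_meas)"
  by (cases "z \<in> I \<times> I") (auto simp: ext_def mem_Times_iff)

lemma inv_integral:
  fixes f :: "real \<times> real \<Rightarrow> complex"
  shows "(\<integral>z. f z \<partial>inv_meas) = (\<integral>z. indicator (I \<times> I) z *\<^sub>R f z \<partial>(marg \<Otimes>\<^sub>M marg))"
  by (subst integral_restrict_space) (auto simp: space_pair_measure)

lemma markov_step:
  fixes F :: "(nat \<Rightarrow> real) \<Rightarrow> (nat \<Rightarrow> real) \<Rightarrow> complex"
  assumes F: "case_prod F \<in> borel_measurable (path_space \<Otimes>\<^sub>M path_space)"
    and F_le: "\<And>x y. norm (F x y) \<le> 1"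
    and h: "h \<in> borel_measurable ref_meas" and h_le: "\<And>w. w \<in> I \<times> I \<Longrightarrow> norm (h w) \<le> B"
  shows "(\<integral>z. F (stopped n (fst z)) (stopped n (snd z)) *
       (indicator (I \<times> I) (pos (Suc n) z) *\<^sub>R h (pos (Suc n) z)) \<partial>PP) =
    (\<integral>z. F (stopped n (fst z)) (stopped n (snd z)) * (\<integral>w. dens (pos n z) w *\<^sub>R h w \<partial>ref_meas) \<partial>PP)"
proof -
  \<comment> \<open>\<open>B\<close> must also bound the value 0 of the extension; a point of
    \<open>I\<close> shows that it is nonnegative.\<close>
  obtain x where "x \<in> I" using I_nonempty by auto
  then have "0 \<le> B" using order_trans[OF norm_ge_zero h_le[of "(x, x)"]] by simp
  then have "norm (indicator (I \<times> I) w *\<^sub>R h w) \<le> B" for w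
    using h_le by (auto split: split_indicator)
  from pair_markov_integral[OF F F_le extend_measurable[OF h] this]
  show ?thesis unfolding trans_integral_eq by simp
qed

lemma finite_ref: "finite_measure ref_meas"
proof (rule finite_measureI)
  have "emeasure ref_meas (space ref_meas) = emeasure (lborel \<Otimes>\<^sub>M lborel) (I \<times> I)"
    unfolding space_ref by (rule emeasure_restrict_space[OF sets.Int[OF I2_lborel sets.top] subset_refl])
  also have "\<dots> = emeasure lborel I * emeasure lborel I"
    by (rule lborel.emeasure_pair_measure_Times) simp_all
  also have "\<dots> \<noteq> \<infinity>" using emeasure_I_finite by (simp add: ennreal_mult_eq_top_iff)
  finally show "emeasure ref_meas (space ref_meas) \<noteq> \<infinity>" .
qed

sublocale ref: finite_measure ref_meas by (rule finite_ref)

lemma proj_ref_measurable [measurable]: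
  "fst \<in> ref_meas \<rightarrow>\<^sub>M borel" "snd \<in> ref_meas \<rightarrow>\<^sub>M borel"
  by (auto intro!: measurable_restrict_space1)

lemma emeasure_marg_I: "emeasure marg I = 1"
proof -
  have "AE x in marg. x \<in> I"
    unfolding marg_def by (subst AE_distr_iff) (auto simp: AE_path_in)
  then show ?thesis
    by (intro marg.emeasure_eq_1_AE) (auto simp: sets_marg)
qed

lemma prob_space_inv: "prob_space inv_meas"
proof
  have "emeasure inv_meas (space inv_meas) = emeasure (marg \<Otimes>\<^sub>M marg) (I \<times> I)"
    unfolding space_inv by (rule emeasure_restrict_space[OF sets.Int[OF I2_marg sets.top] subset_refl])
  also have "\<dots> = emeasure marg I * emeasure marg I"
    by (rule marg.emeasure_pair_measure_Times) (simp_all add: sets_marg)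
  finally show "emeasure inv_meas (space inv_meas) = 1"
    by (simp add: emeasure_marg_I)
qed

lemma dens_total:
  assumes "z \<in> I \<times> I"
  shows "(\<integral>w. dens z w \<partial>ref_meas) = 1"
proof -
  have "complex_of_real (\<integral>w. dens z w \<partial>ref_meas) = (\<integral>w. dens z w *\<^sub>R (1 :: complex) \<partial>ref_meas)"
    by (subst integral_complex_of_real[symmetric]) (simp add: scaleR_conv_of_real)
  also have "\<dots> = (\<integral>w. dens z w *\<^sub>R (1 :: complex) \<partial>(lborel \<Otimes>\<^sub>M lborel))"
    unfolding trans_integral_eq
    by (rule Bochner_Integration.integral_cong) (auto simp: ext_def split: split_indicator)
  also have "\<dots> = (\<integral>v. ext (snd z) v *\<^sub>R (\<integral>u. ext (fst z) u *\<^sub>R (1 :: complex) \<partial>lborel) \<partial>lborel)"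
    by (rule ext_product_integral(1)[where B=1]) auto
  also have "\<dots> = 1"
    using assms by (auto simp: ext_integrable ext_total)
  finally show ?thesis by simp
qed

lemma sets_ref_iff: "D \<in> sets ref_meas \<longleftrightarrow> D \<subseteq> I \<times> I \<and> D \<in> sets (borel \<Otimes>\<^sub>M borel)"
  unfolding sets_ref using I2 by (subst sets_restrict_space_iff) (auto simp: space_pair_measure)

text \<open>The density of the pair is a product, hence the squared constants. Invariance is one
  Markov step from time 0 to time 1, read between two equal coordinate laws.\<close>

sublocale kernel: doeblin_kernel ref_meas inv_meas dens "c * c" "C * C"
proof (unfold doeblin_kernel_def doeblin_kernel_axioms_def, intro conjI allI impI)
  show "finite_measure ref_meas" by (rule finite_ref)
  show "prob_space inv_meas" by (rule prob_space_inv)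
  show "sets inv_meas = sets ref_meas"
    by (intro sets_restrict_space_cong sets_pair_measure_cong) (auto simp: sets_marg)
  show "(\<lambda>(z, w). dens z w) \<in> borel_measurable (ref_meas \<Otimes>\<^sub>M ref_meas)"
    by measurable
  show "0 < c * c" using c_pos by simp
  fix z assume z: "z \<in> space ref_meas"
  show "(\<integral>w. dens z w \<partial>ref_meas) = 1"
    using z by (intro dens_total) (simp add: space_ref)
  fix w assume w: "w \<in> space ref_meas"
  show "c * c \<le> dens z w" "dens z w \<le> C * C"
    using z w c_pos p_lower unfolding space_ref
    by (auto intro!: mult_mono ext_upper ext_nonneg simp: C_nonneg) (auto simp: ext_def)
next
  fix h :: "real \<times> real \<Rightarrow> complex" and B
  assume h: "h \<in> borel_measurable ref_meas" and le: "\<forall>z. z \<in> space ref_meas \<longrightarrow> norm (h z) \<le> B"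
  let ?Q = "\<lambda>z. \<integral>w. dens z w *\<^sub>R h w \<partial>ref_meas"
  \<comment> \<open>Measurability is required on the whole plane because positions of arbitrary real
    paths are substituted.\<close>
  have Q: "?Q \<in> borel_measurable (borel \<Otimes>\<^sub>M borel)"
  proof (rule ref.borel_measurable_lebesgue_integral, unfold case_prod_unfold)
    show "(\<lambda>x. dens (fst x) (snd x) *\<^sub>R h (snd x)) \<in> borel_measurable ((borel \<Otimes>\<^sub>M borel) \<Otimes>\<^sub>M ref_meas)"
      by (intro borel_measurable_scaleR borel_measurable_times ext_measurable
          measurable_compose[OF measurable_snd h]
          measurable_compose[OF measurable_snd proj_ref_measurable(1)]
          measurable_compose[OF measurable_snd proj_ref_measurable(2)]
          measurable_compose[OF measurable_fst measurable_fst]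
          measurable_compose[OF measurable_fst measurable_snd])
  qed
  have "(\<integral>z. ?Q z \<partial>inv_meas) = (\<integral>z. ?Q (pos 0 z) \<partial>PP)"
    unfolding inv_integral trans_integral_outside
    by (rule coordinate_integral[OF Q, symmetric]) simp
  also have "\<dots> = (\<integral>z. indicator (I \<times> I) (pos (Suc 0) z) *\<^sub>R h (pos (Suc 0) z) \<partial>PP)"
    using markov_step[of "\<lambda>_ _. 1" h B 0] h le by (simp add: space_ref)
  also have "\<dots> = (\<integral>z. h z \<partial>inv_meas)"
    unfolding inv_integral
    by (rule coordinate_integral[OF extend_measurable[OF h]]) simp
  finally show "(\<integral>z. ?Q z \<partial>inv_meas) = (\<integral>z. h z \<partial>inv_meas)" .
qed

text \<open>\<open>gen m\<close> at time n stands for the conditional expectation of the m weights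
  after time n. Each induction step trades the explicit weight at time n + 1 for one more level of
  \<open>gen\<close> by the Markov property; n varies because the hypothesis is used at n +
  1.\<close>

lemma product_integral:
  assumes D: "D \<in> sets ref_meas" and s: "norm s = 1"
  shows "(\<integral>z. (\<Prod>i\<le>n. kernel.weight D s (pos i z)) *
      (indicator (I \<times> I) (pos n z) *\<^sub>R kernel.gen D s m (pos n z)) \<partial>PP) =
    (\<integral>z. (\<Prod>i\<le>n + m. kernel.weight D s (pos i z)) \<partial>PP)"
proof (induction m arbitrary: n)
  case 0
  have [measurable]: "D \<in> sets (borel \<Otimes>\<^sub>M borel)" using D by (simp add: sets_ref_iff)
  \<comment> \<open>At m = 0 only the indicator is left, and it is 1 almost surely.\<close>
  show ?case
    unfolding kernel.weight_def[OF D s] kernel.gen.simps[OF D s]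
    by (rule integral_cong_AE; (measurable; fail)?) (use AE_PP_in[of n] in \<open>eventually_elim, simp\<close>)
next
  case (Suc m)
  have [measurable]: "D \<in> sets (borel \<Otimes>\<^sub>M borel)" using D by (simp add: sets_ref_iff)
  let ?\<phi> = "kernel.weight D s"
  let ?F = "\<lambda>x y. \<Prod>i\<le>n. ?\<phi> (x i, y i)"
  let ?h = "\<lambda>w. ?\<phi> w * kernel.gen D s m w"
  have 1: "case_prod ?F \<in> borel_measurable (path_space \<Otimes>\<^sub>M path_space)"
    unfolding kernel.weight_def[OF D s] by measurable
  \<comment> \<open>The weights up to time n read only coordinates that freezing at n
    preserves.\<close>
  have stop: "?F (stopped n x) (stopped n y) = ?F x y" for x y
    by (intro prod.cong) (auto simp: stopped_apply)
  have "(\<integral>z. (\<Prod>i\<le>n + Suc m. ?\<phi> (pos i z)) \<partial>PP) =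
      (\<integral>z. (\<Prod>i\<le>Suc n. ?\<phi> (pos i z)) * (indicator (I \<times> I) (pos (Suc n) z) *\<^sub>R kernel.gen D s m (pos (Suc n) z)) \<partial>PP)"
    using Suc[of "Suc n"] by simp
  also have "\<dots> = (\<integral>z. ?F (stopped n (fst z)) (stopped n (snd z)) * (indicator (I \<times> I) (pos (Suc n) z) *\<^sub>R ?h (pos (Suc n) z)) \<partial>PP)"
    unfolding stop by (simp add: mult_ac)
  also have "\<dots> = (\<integral>z. ?F (stopped n (fst z)) (stopped n (snd z)) * (\<integral>w. dens (pos n z) w *\<^sub>R ?h w \<partial>ref_meas) \<partial>PP)"
    by (rule markov_step[where B=1])
       (use 1 D s kernel.norm_gen_le[OF D s] in
         \<open>auto simp: norm_mult kernel.norm_weight[OF D s] prod_norm[symmetric] space_ref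
           intro!: borel_measurable_times kernel.weight_measurable kernel.gen_measurable\<close>)
  finally show ?case
    unfolding stop kernel.gen.simps[OF D s] kernel.trans_op_def trans_integral_outside by simp
qed

text \<open>The weight at time 0 stays explicit, the n later ones are absorbed into
  \<open>gen n\<close>, and \<open>gen_mean_Suc\<close> recognises the resulting integral.\<close>

lemma product_integral_eq_gen_mean:
  assumes D: "D \<in> sets ref_meas" and s: "norm s = 1"
  shows "(\<integral>z. (\<Prod>i\<le>n. kernel.weight D s (pos i z)) \<partial>PP) = kernel.gen_mean D s (Suc n)"
proof -
  let ?h = "\<lambda>w. kernel.weight D s w * kernel.gen D s n w"
  have "(\<integral>z. (\<Prod>i\<le>n. kernel.weight D s (pos i z)) \<partial>PP) =
      (\<integral>z. indicator (I \<times> I) (pos 0 z) *\<^sub>R ?h (pos 0 z) \<partial>PP)"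
    using product_integral[OF D s, where n=0 and m=n] by (simp add: mult_ac)
  also have "\<dots> = (\<integral>z. ?h z \<partial>inv_meas)"
    unfolding inv_integral
    by (rule coordinate_integral[OF extend_measurable])
       (use kernel.weight_measurable[OF D s] kernel.gen_measurable[OF D s] in auto)
  finally show ?thesis by (simp add: kernel.gen_mean_Suc[OF D s])
qed

section \<open>Size of the neighbourhood of the diagonal\<close>

lemma near_diagonal_measurable: "near_diagonal I \<delta> \<in> sets ref_meas"
proof -
  have "near_diagonal I \<delta> = {z \<in> space (borel \<Otimes>\<^sub>M borel). fst z \<in> I \<and> snd z \<in> I \<and> \<bar>fst z - snd z\<bar> \<le> \<delta>}"
    by (auto simp: near_diagonal_def space_pair_measure)
  also have "\<dots> \<in> sets (borel \<Otimes>\<^sub>M borel)" by measurable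
  finally show ?thesis by (auto simp: sets_ref_iff near_diagonal_def)
qed

text \<open>Sections over points of \<open>I\<close> lie in intervals of length 2 \<delta>; all
  others are empty.\<close>

lemma measure_ref_near_diagonal_le:
  assumes \<delta>: "0 < \<delta>"
  shows "measure ref_meas (near_diagonal I \<delta>) \<le> 2 * \<delta> * measure lborel I"
proof -
  let ?D = "near_diagonal I \<delta>"
  have D: "?D \<in> sets (lborel \<Otimes>\<^sub>M lborel)"
    using near_diagonal_measurable sets_ref_iff sets_pair_measure_cong[OF sets_lborel sets_lborel]
    by metis
  have "emeasure ref_meas ?D = emeasure (lborel \<Otimes>\<^sub>M lborel) ?D"
    by (rule emeasure_restrict_space[OF sets.Int[OF I2_lborel sets.top]]) (auto simp: near_diagonal_def)
  also have "\<dots> = (\<integral>\<^sup>+x. emeasure lborel (Pair x -` ?D) \<partial>lborel)"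
    by (rule lborel.emeasure_pair_measure_alt[OF D])
  also have "\<dots> \<le> (\<integral>\<^sup>+x. ennreal (2 * \<delta>) * indicator I x \<partial>lborel)"
  proof (rule nn_integral_mono)
    fix x :: real
    show "emeasure lborel (Pair x -` ?D) \<le> ennreal (2 * \<delta>) * indicator I x"
    proof (cases "x \<in> I")
      case True
      have "emeasure lborel (Pair x -` ?D) \<le> emeasure lborel {x - \<delta>..x + \<delta>}"
        by (rule emeasure_mono) (auto simp: near_diagonal_def)
      with True \<delta> show ?thesis by simp
    next
      case False
      then have "Pair x -` ?D = {}" by (auto simp: near_diagonal_def)
      then show ?thesis by simp
    qed
  qed
  also have "\<dots> = ennreal (2 * \<delta> * measure lborel I)"
    using \<delta> emeasure_I_finite by (simp add: nn_integral_cmult_indicator emeasure_eq_ennreal_measure ennreal_mult)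
  finally show ?thesis
    using \<delta> by (simp add: ref.emeasure_eq_measure)
qed

text \<open>Countably many half-open cells of length \<delta> cover \<open>I\<close>, so one has
  positive mass, and two points of one cell are \<delta>-close. Positivity makes the number of steps
  a genuine quotient, as division by 0 would give 0.\<close>

lemma measure_inv_near_diagonal_pos:
  assumes \<delta>: "0 < \<delta>"
  shows "0 < measure inv_meas (near_diagonal I \<delta>)"
proof -
  let ?J = "\<lambda>k::int. {of_int k * \<delta>..<of_int (k + 1) * \<delta>} \<inter> I"
  have I1: "emeasure marg I = 1"
    using emeasure_marg_I .
  have "I = (\<Union>k. ?J k)"
  proof safe
    fix x assume "x \<in> I"
    moreover have "of_int \<lfloor>x / \<delta>\<rfloor> * \<delta> \<le> x" "x < of_int (\<lfloor>x / \<delta>\<rfloor> + 1) * \<delta>"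
      using \<delta> floor_correct[of "x / \<delta>"]
      by (simp_all only: pos_le_divide_eq pos_divide_less_eq)
    ultimately show "x \<in> (\<Union>k. ?J k)" by auto
  qed
  have "\<exists>k. emeasure marg (?J k) \<noteq> 0"
  proof (rule ccontr)
    assume "\<not> ?thesis"
    then have "(\<Union>k. ?J k) \<in> null_sets marg"
      by (intro null_sets_UN null_setsI) (auto simp: sets_marg)
    with I1 \<open>I = _\<close> show False by (simp add: null_setsD1)
  qed
  then obtain k where k: "emeasure marg (?J k) \<noteq> 0" by blast
  have sub: "?J k \<times> ?J k \<subseteq> near_diagonal I \<delta>"
    by (auto simp: near_diagonal_def abs_le_iff algebra_simps)
  have J: "?J k \<times> ?J k \<in> sets (marg \<Otimes>\<^sub>M marg)"
    by (rule pair_measureI) (auto simp: sets_marg)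
  have "emeasure marg (?J k) * emeasure marg (?J k) = emeasure (marg \<Otimes>\<^sub>M marg) (?J k \<times> ?J k)"
    by (rule marg.emeasure_pair_measure_Times[symmetric]) (auto simp: sets_marg)
  also have "\<dots> = emeasure inv_meas (?J k \<times> ?J k)"
    by (rule emeasure_restrict_space[OF sets.Int[OF I2_marg sets.top], symmetric]) auto
  also have "\<dots> \<le> emeasure inv_meas (near_diagonal I \<delta>)"
    using sub near_diagonal_measurable by (intro emeasure_mono) (auto simp: kernel.sets_inv)
  finally have "emeasure inv_meas (near_diagonal I \<delta>) \<noteq> 0" using k by auto
  then show ?thesis by (simp add: kernel.emeasure_eq_measure zero_less_measure_iff)
qed

text \<open>Independence makes the joint law of the trajectories a product, and the copy shares the
  path law; so everything proved under \<open>PP\<close> applies to the given pair.\<close>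

lemma pair_law_eq:
  assumes "independent_copy M X Y"
  shows "pair_law M X Y = distr PP (PiM UNIV (\<lambda>_. borel \<Otimes>\<^sub>M borel)) (\<lambda>z n. pos n z)"
proof -
  have iv: "indep_var path_space (trajectory X) path_space (trajectory Y)"
    and law: "distr M path_space (trajectory Y) = path_law"
    using assms by (simp_all add: independent_copy_def path_law_def)
  have [measurable]: "trajectory Y \<in> M \<rightarrow>\<^sub>M path_space"
    using iv by (rule indep_var_rv2)
  have PP: "PP = distr M (path_space \<Otimes>\<^sub>M path_space) (\<lambda>\<omega>. (trajectory X \<omega>, trajectory Y \<omega>))"
    using iv law unfolding indep_var_distribution_eq path_law_def by simp
  have [measurable]: "(\<lambda>z n. pos n z) \<in> path_space \<Otimes>\<^sub>M path_space \<rightarrow>\<^sub>M PiM UNIV (\<lambda>_. borel \<Otimes>\<^sub>M borel)"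
    by (rule measurable_PiM_single') (auto simp: space_pair_measure)
  show ?thesis
    unfolding PP pair_law_def
    by (subst distr_distr, measurable) (simp add: comp_def trajectory_def[abs_def])
qed

section \<open>The number of visits under the pair law\<close>

context
  fixes Y :: "nat \<Rightarrow> 'a \<Rightarrow> real" and \<delta> :: real and P2 :: "(nat \<Rightarrow> real \<times> real) measure"
  assumes copy: "independent_copy M X Y"
  defines "P2 \<equiv> pair_law M X Y"
begin

abbreviation (input) "D \<equiv> near_diagonal I \<delta>"

lemma D_measurable: "D \<in> sets (borel \<Otimes>\<^sub>M borel)"
  using near_diagonal_measurable by (simp add: sets_ref_iff)

lemma P2_eq: "P2 = distr PP (PiM UNIV (\<lambda>_. borel \<Otimes>\<^sub>M borel)) (\<lambda>z n. pos n z)"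
  unfolding P2_def by (rule pair_law_eq[OF copy])

lemma positions_measurable:
  "(\<lambda>z n. pos n z) \<in> PP \<rightarrow>\<^sub>M PiM UNIV (\<lambda>_. borel \<Otimes>\<^sub>M borel)"
  by (rule measurable_PiM_single') (auto simp: space_pair_measure)

lemma visits_measurable: "visits P2 I t \<delta> \<in> borel_measurable P2"
proof -
  note D_measurable [measurable]
  show ?thesis unfolding visits_def[abs_def] unfolding P2_eq by measurable
qed

text \<open>Identifies the denominator in \<open>num_steps\<close> with the stationary mass that the
  kernel estimates use.\<close>

lemma hit_prob: "measure P2 {z \<in> space P2. z 0 \<in> D} = measure inv_meas D"
proof -
  note D_measurable [measurable] and positions_measurable [measurable]
  have "{z \<in> space (PiM UNIV (\<lambda>_. borel \<Otimes>\<^sub>M borel)). z (0::nat) \<in> D} \<in> sets (PiM UNIV (\<lambda>_. borel \<Otimes>\<^sub>M borel))"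
    by measurable
  then have "measure P2 {z \<in> space P2. z 0 \<in> D} = measure PP ((\<lambda>z. pos 0 z) -` D \<inter> space PP)"
    unfolding P2_eq space_distr
    by (subst measure_distr[OF positions_measurable])
       (use measurable_space[OF positions_measurable] in \<open>auto intro!: arg_cong[where f="measure PP"]\<close>)
  also have "\<dots> = measure (marg \<Otimes>\<^sub>M marg) D"
    unfolding coordinate_pair_law[of 0, symmetric, simplified]
    by (rule measure_distr[symmetric]) measurable
  also have "\<dots> = measure inv_meas D"
    by (rule measure_restrict_space[OF sets.Int[OF I2_marg sets.top], symmetric])
       (auto simp: near_diagonal_def)
  finally show ?thesis .
qed

text \<open>The exponential of the sum is a product of weights with s = exp (i \<theta>). The sum
  runs over 0 to N, which is N + 1 weights; hence \<open>Suc\<close>.\<close>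

lemma char_visits:
  "char (distr P2 borel (visits P2 I t \<delta>)) \<theta> =
    kernel.gen_mean D (iexp \<theta>) (Suc (nat \<lfloor>t / measure inv_meas D\<rfloor>))"
proof -
  note D_measurable [measurable] and positions_measurable [measurable]
  let ?N = "nat \<lfloor>t / measure inv_meas D\<rfloor>"
  have N: "num_steps P2 I t \<delta> = ?N" by (simp add: num_steps_def hit_prob)
  have Dr: "D \<in> sets ref_meas" by (rule near_diagonal_measurable)
  have s: "norm (iexp \<theta>) = 1" by simp
  have *: "iexp (\<theta> * visits P2 I t \<delta> z) = (\<Prod>i\<le>?N. kernel.weight D (iexp \<theta>) (z i))" for z
  proof -
    have "iexp (\<theta> * visits P2 I t \<delta> z) = (\<Prod>i\<le>?N. iexp (\<theta> * indicator D (z i)))"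
      unfolding visits_def N sum_distrib_left of_real_sum atMost_atLeast0 by (rule exp_sum) simp
    also have "\<dots> = (\<Prod>i\<le>?N. kernel.weight D (iexp \<theta>) (z i))"
      unfolding kernel.weight_def[OF Dr s] by (intro prod.cong) (auto split: split_indicator)
    finally show ?thesis .
  qed
  have "char (distr P2 borel (visits P2 I t \<delta>)) \<theta> = (\<integral>z. iexp (\<theta> * visits P2 I t \<delta> z) \<partial>P2)"
    unfolding char_def by (rule integral_distr[OF visits_measurable]) measurable
  also have "\<dots> = (\<integral>z. (\<Prod>i\<le>?N. kernel.weight D (iexp \<theta>) (z i)) \<partial>P2)"
    by (simp only: *)
  also have "\<dots> = (\<integral>z. (\<Prod>i\<le>?N. kernel.weight D (iexp \<theta>) (pos i z)) \<partial>PP)"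
    unfolding kernel.weight_def[OF Dr s] P2_eq
    by (rule integral_distr) measurable
  also have "\<dots> = kernel.gen_mean D (iexp \<theta>) (Suc ?N)"
    by (rule product_integral_eq_gen_mean[OF Dr s])
  finally show ?thesis .
qed

lemma real_distribution_visits: "real_distribution (distr P2 borel (visits P2 I t \<delta>))"
proof -
  interpret P2: prob_space P2
    unfolding P2_eq by (rule PP.prob_space_distr[OF positions_measurable])
  show ?thesis by (rule P2.real_distribution_distr[OF visits_measurable])
qed

end

lemma hit_prob_tendsto_0:
  assumes "filterlim d (at_right 0) sequentially"
  shows "(\<lambda>n. measure inv_meas (near_diagonal I (d n))) \<longlonglongrightarrow> 0"
proof (rule Lim_null_comparison)
  have d: "d \<longlonglongrightarrow> 0" "eventually (\<lambda>n. 0 < d n) sequentially"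
    using assms by (auto simp: filterlim_at elim: eventually_mono)
  show "eventually (\<lambda>n. norm (measure inv_meas (near_diagonal I (d n)))
      \<le> C * C * (2 * d n * measure lborel I)) sequentially"
    using d(2)
  proof eventually_elim
    case (elim n)
    have "measure inv_meas (near_diagonal I (d n)) \<le> C * C * measure ref_meas (near_diagonal I (d n))"
      by (rule kernel.measure_inv_bounds(2)[OF near_diagonal_measurable])
    also have "\<dots> \<le> C * C * (2 * d n * measure lborel I)"
      by (intro mult_left_mono measure_ref_near_diagonal_le elim) (simp add: C_nonneg)
    finally show ?case by simp
  qed
  have "(\<lambda>n. C * C * (2 * d n * measure lborel I)) \<longlonglongrightarrow> C * C * (2 * 0 * measure lborel I)"
    by (intro tendsto_intros d)
  then show "(\<lambda>n. C * C * (2 * d n * measure lborel I)) \<longlonglongrightarrow> 0" by simp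
qed

lemma char_visits_tendsto:
  assumes copy: "independent_copy M X Y" and d: "filterlim d (at_right 0) sequentially"
    and t: "0 < t"
  shows "(\<lambda>n. char (distr (pair_law M X Y) borel (visits (pair_law M X Y) I t (d n))) \<theta>)
    \<longlonglongrightarrow> exp (of_real t * (iexp \<theta> - 1))"
proof (rule poisson_limit_of_bounds[OF _ t kernel.defect_bounds _ hit_prob_tendsto_0[OF d]])
  have pos: "eventually (\<lambda>n. 0 < d n) sequentially"
    using d by (auto simp: filterlim_at elim: eventually_mono)
  show "norm (iexp \<theta>) = 1" by simp
  show "0 \<le> C * C / (c * c)" using c_pos C_nonneg by simp
  show "eventually (\<lambda>n. 0 < measure inv_meas (near_diagonal I (d n))) sequentially"
    using pos by eventually_elim (rule measure_inv_near_diagonal_pos)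
  show "eventually (\<lambda>n. norm (char (distr (pair_law M X Y) borel (visits (pair_law M X Y) I t (d n))) \<theta>
      - (1 + (iexp \<theta> - 1) * of_real (measure inv_meas (near_diagonal I (d n)))) ^
          Suc (nat \<lfloor>t / measure inv_meas (near_diagonal I (d n))\<rfloor>))
      \<le> real (Suc (nat \<lfloor>t / measure inv_meas (near_diagonal I (d n))\<rfloor>)) *
        (2 * measure inv_meas (near_diagonal I (d n)) *
          (4 * real m * (C * C / (c * c)) * measure inv_meas (near_diagonal I (d n)) + 2 * kernel.defect ^ m)))
      sequentially" for m
    using pos
  proof eventually_elim
    case (elim n)
    show ?case
      unfolding char_visits[OF copy]
      by (rule kernel.gen_mean_near_power[OF near_diagonal_measurable]) simp
  qed
qed

end

text \<open>\<open>weak_conv_m\<close> concerns sequences, so the limit in \<delta> is taken along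
  every sequence tending to 0 from the right.\<close>

theorem mainTheorem8:
  fixes M :: "'a measure"
    and X Y :: "nat \<Rightarrow> 'a \<Rightarrow> real"
    and I :: "real set"
    and p :: "real \<Rightarrow> real \<Rightarrow> real"
    and P2 :: "(nat \<Rightarrow> real \<times> real) measure"
    and t :: real
  defines "P2 \<equiv> pair_law M X Y"
  assumes "prob_space M"
    and "I \<in> sets borel"
    and "markov_chain M I p X"
    and "stationary M X"
    and "\<exists>C. \<forall>x\<in>I. \<forall>y\<in>I. p x y \<le> C"
    and "\<exists>c>0. \<forall>x\<in>I. \<forall>y\<in>I. c \<le> p x y"
    and "independent_copy M X Y"
    and "0 < t"
  shows "\<forall>d :: nat \<Rightarrow> real. filterlim d (at_right 0) sequentially \<longrightarrow>
           weak_conv_m (\<lambda>n. distr P2 borel (visits P2 I t (d n)))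
                       (distr (measure_pmf (poisson_pmf t)) borel real)"
proof (intro allI impI)
  fix d :: "nat \<Rightarrow> real"
  assume d: "filterlim d (at_right 0) sequentially"
  interpret prob_space M by fact
  obtain C where C: "\<forall>x\<in>I. \<forall>y\<in>I. p x y \<le> C" using assms by blast
  obtain c where c: "0 < c" "\<forall>x\<in>I. \<forall>y\<in>I. c \<le> p x y" using assms by blast
  \<comment> \<open>A probability space has a point, and the chain maps it into
    \<open>I\<close>.\<close>
  have "I \<noteq> {}"
    using \<open>markov_chain M I p X\<close> not_empty by (auto simp: markov_chain_def)
  then interpret pair_chain M I p c C X
    using assms C c by unfold_locales (auto simp: markov_chain_def)
  show "weak_conv_m (\<lambda>n. distr P2 borel (visits P2 I t (d n)))
      (distr (measure_pmf (poisson_pmf t)) borel real)"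
  proof (rule levy_continuity)
    show "real_distribution (distr P2 borel (visits P2 I t (d n)))" for n
      unfolding P2_def by (rule real_distribution_visits[OF assms(8)])
    show "real_distribution (distr (measure_pmf (poisson_pmf t)) borel real)"
      by (rule prob_space.real_distribution_distr[OF measure_pmf.prob_space_axioms]) simp
    show "(\<lambda>n. char (distr P2 borel (visits P2 I t (d n))) \<theta>)
        \<longlonglongrightarrow> char (distr (measure_pmf (poisson_pmf t)) borel real) \<theta>" for \<theta>
      using char_visits_tendsto[OF assms(8) d \<open>0 < t\<close>] \<open>0 < t\<close> unfolding P2_def
      by (simp add: char_poisson)
  qed
qed

end
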